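(* Let $\mathcal{E}$ be a cartesian closed category with finite coproducts and let $T=(T,\eta,\mu)$ be a commutative (strong) monad on $\mathcal{E}$ which takes finite coproducts to products and for which the canonical abelian monoid structures on the objects $T(X)$ are abelian group structures. Let $R:=T(\mathbf{1})$, let $D\subseteq R$ be a fixed subobject, and assume that $R$ and every $R$-module of the form $T(X)$ satisfy the KL axiom with respect to $D$. Let $X$ be an object of $\mathcal{E}$. For $P\in T(R)$ and $\phi\in R\pitchfork T(X)$, one has $$\langle P',\phi\rangle=-\langle P,\phi'\rangle.$$
   Context: $\mathcal{E}$ has terminal object $\mathbf{1}$ and initial object $\emptyset$; the exponential object $B^{X}$ is written $X\pitchfork B$. Statements are written with elements as if $\mathcal{E}$ were the category of sets; elements are generalized elements and equations between elements mean equality of the corresponding morphisms (for $f$ depending on parameters, $T(f)$ is formed using the strength of $T$). For $f:X\to Y$ write $f_{*}:=T(f)$. "$T$-linear" means homomorphism of $T$-algebras. For a $T$-algebra $(B,\beta)$, $P\in T(X)$ and $\phi\in X\pitchfork B$, the pairing is $\langle P,\phi\rangle:=\beta(\phi_{*}(P))\in B$; $T(X)$ is a $T$-algebra via $\mu_X$. The strength of $T$ gives maps $t_{X,Y}:X\times T(Y)\to T(X\times Y)$, $(x,Q)\mapsto T(y\mapsto(x,y))(Q)$, and symmetrically $t'_{X,Y}:T(X)\times Y\to T(X\times Y)$; $T$ is commutative if $\mu\circ T(t)\circ t'=\mu\circ T(t')\circ t$ for all $X,Y$, and the common map is denoted $\otimes:T(X)\times T(Y)\to T(X\times Y)$. Multiplication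 on $R$ is $\otimes:T(\mathbf{1})\times T(\mathbf{1})\to T(\mathbf{1}\times\mathbf{1})\cong T(\mathbf{1})$ with unit $\eta_{\mathbf{1}}$; $R$ acts on $T(X)$ by $\lambda\cdot P:=\lambda\otimes P\in T(\mathbf{1}\times X)\cong T(X)$. "$T$ takes finite coproducts to products" means that $T(\emptyset)$ is terminal and that, for all $X,Y$, the canonical $T$-linear map $\Phi_{X,Y}:T(X+Y)\to T(X)\times T(Y)$ is an isomorphism, where $\Phi_{X,Y}$ is the unique $T$-linear map whose composite with $\eta_{X+Y}$ is $(\eta_X,0)$ on $X$ and $(0,\eta_Y)$ on $Y$, with $0:X\to T(Y)$ the composite $X\to\mathbf{1}\cong T(\emptyset)\to T(Y)$ (and similarly $0:Y\to T(X)$). The addition on $T(X)$ is $T(X)\times T(X)\xrightarrow{\Phi_{X,X}^{-1}}T(X+X)\xrightarrow{T(\nabla)}T(X)$, with $\nabla$ the codiagonal. With these structures $R$ is a commutative ring and each $T(X)$ is an $R$-module. An $R$-module $V$ satisfies the KL axiom (with respect to $D$) if for any $f:R\to V$ there exists a unique $f':R\to V$ such that $f(x+d)=f(x)+d\cdot f'(x)$ for all $x\in R$, $d\in D$; $f'$ is called the derivative of $f$. (In a general $\mathcal{E}$ this is read internally: for every object $I$ and $f:I\times R\to V$ there is a unique $f':I\times R\to V$ with $f(i,x+d)=f(i,x)+d\cdot f'(i,x)$ for all $i,x$ and all $d\in D$.) In the claim $\phi'$ is the derivative of $\phi:R\to T(X)$ in this sense. For $u\in R$, $\alpha^{u}:R\to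 R$ is $x\mapsto x+u$. For $P\in T(R)$, the derivative $P'\in T(R)$ is the unique element such that $d\cdot P'=P-\alpha^{d}_{*}(P)$ for all $d\in D$ (it exists uniquely by KL for $T(R)$). *)

theory Defs
  imports Main
begin

section \<open>Cartesian closed categories with finite coproducts\<close>

record ('o, 'm) cat =
  Obj :: "'o set"
  Arr :: "'m set"
  Dom :: "'m \<Rightarrow> 'o"
  Cod :: "'m \<Rightarrow> 'o"
  Id :: "'o \<Rightarrow> 'm"
  Comp :: "'m \<Rightarrow> 'm \<Rightarrow> 'm"  (infixr "\<cdot>\<index>" 70)

definition hom :: "('o, 'm, 'x) cat_scheme \<Rightarrow> 'o \<Rightarrow> 'o \<Rightarrow> 'm set" where
  "hom E A B = {f \<in> Arr E. Dom E f = A \<and> Cod E f = B}"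

locale category =
  fixes E :: "('o, 'm, 'x) cat_scheme" (structure)
  assumes Dom_Obj: "f \<in> Arr E \<Longrightarrow> Dom E f \<in> Obj E"
    and Cod_Obj: "f \<in> Arr E \<Longrightarrow> Cod E f \<in> Obj E"
    and Id_hom: "A \<in> Obj E \<Longrightarrow> Id E A \<in> hom E A A"
    and Comp_hom: "\<lbrakk>f \<in> hom E A B; g \<in> hom E B C\<rbrakk> \<Longrightarrow> g \<cdot> f \<in> hom E A C"
    and Comp_Id: "f \<in> hom E A B \<Longrightarrow> f \<cdot> Id E A = f"
    and Id_Comp: "f \<in> hom E A B \<Longrightarrow> Id E B \<cdot> f = f"
    and Comp_assoc: "\<lbrakk>f \<in> hom E A B; g \<in> hom E B C; h \<in> hom E C K\<rbrakk>
      \<Longrightarrow> (h \<cdot> g) \<cdot> f = h \<cdot> (g \<cdot> f)"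
begin

definition mono_arr :: "'m \<Rightarrow> bool" where
  "mono_arr f \<longleftrightarrow> f \<in> Arr E \<and>
     (\<forall>J\<in>Obj E. \<forall>a \<in> hom E J (Dom E f). \<forall>b \<in> hom E J (Dom E f). f \<cdot> a = f \<cdot> b \<longrightarrow> a = b)"

definition inverse_arr :: "'m \<Rightarrow> 'm \<Rightarrow> bool" where
  "inverse_arr f g \<longleftrightarrow> f \<in> Arr E \<and> g \<in> hom E (Cod E f) (Dom E f) \<and>
     g \<cdot> f = Id E (Dom E f) \<and> f \<cdot> g = Id E (Cod E f)"

definition iso_arr :: "'m \<Rightarrow> bool" where
  "iso_arr f \<longleftrightarrow> (\<exists>g. inverse_arr f g)"

definition inv_arr :: "'m \<Rightarrow> 'm" where
  "inv_arr f = (THE g. inverse_arr f g)"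

definition terminal_obj :: "'o \<Rightarrow> bool" where
  "terminal_obj A \<longleftrightarrow> A \<in> Obj E \<and> (\<forall>C\<in>Obj E. \<exists>!h. h \<in> hom E C A)"

definition initial_obj :: "'o \<Rightarrow> bool" where
  "initial_obj A \<longleftrightarrow> A \<in> Obj E \<and> (\<forall>C\<in>Obj E. \<exists>!h. h \<in> hom E A C)"

end

text \<open>A choice of terminal and initial object, binary products, exponentials and binary
  coproducts.  \<open>Exp A B\<close> is the exponential object $B^A$, with evaluation
  \<open>ev A B\<close> from \<open>Exp A B \<times>\<^sub>c A\<close> to \<open>B\<close>.\<close>

record ('o, 'm) bccc = "('o, 'm) cat" +
  Terminal :: 'o  ("\<one>\<index>")
  Initial :: 'o
  Prod :: "'o \<Rightarrow> 'o \<Rightarrow> 'o"  (infixr "\<times>\<^sub>c\<index>" 75)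
  pr1 :: "'o \<Rightarrow> 'o \<Rightarrow> 'm"
  pr2 :: "'o \<Rightarrow> 'o \<Rightarrow> 'm"
  Exp :: "'o \<Rightarrow> 'o \<Rightarrow> 'o"
  ev :: "'o \<Rightarrow> 'o \<Rightarrow> 'm"
  Coprod :: "'o \<Rightarrow> 'o \<Rightarrow> 'o"  (infixr "+\<^sub>c\<index>" 73)
  in1 :: "'o \<Rightarrow> 'o \<Rightarrow> 'm"
  in2 :: "'o \<Rightarrow> 'o \<Rightarrow> 'm"

locale finite_product_category = category E
  for E :: "('o, 'm) bccc" (structure) +
  assumes Terminal: "terminal_obj \<one>"
    and Prod_Obj: "\<lbrakk>A \<in> Obj E; B \<in> Obj E\<rbrakk> \<Longrightarrow> A \<times>\<^sub>c B \<in> Obj E"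
    and pr1_hom: "\<lbrakk>A \<in> Obj E; B \<in> Obj E\<rbrakk> \<Longrightarrow> pr1 E A B \<in> hom E (A \<times>\<^sub>c B) A"
    and pr2_hom: "\<lbrakk>A \<in> Obj E; B \<in> Obj E\<rbrakk> \<Longrightarrow> pr2 E A B \<in> hom E (A \<times>\<^sub>c B) B"
    and Prod_univ: "\<lbrakk>f \<in> hom E C A; g \<in> hom E C B\<rbrakk>
      \<Longrightarrow> \<exists>!h. h \<in> hom E C (A \<times>\<^sub>c B) \<and> pr1 E A B \<cdot> h = f \<and> pr2 E A B \<cdot> h = g"
begin

definition bang :: "'o \<Rightarrow> 'm" where
  "bang A = (THE h. h \<in> hom E A \<one>)"

definition pair :: "'m \<Rightarrow> 'm \<Rightarrow> 'm"  ("\<langle>_, _\<rangle>") where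
  "\<langle>f, g\<rangle> = (THE h. h \<in> hom E (Dom E f) (Cod E f \<times>\<^sub>c Cod E g) \<and>
     pr1 E (Cod E f) (Cod E g) \<cdot> h = f \<and> pr2 E (Cod E f) (Cod E g) \<cdot> h = g)"

definition prod_map :: "'m \<Rightarrow> 'm \<Rightarrow> 'm" where
  "prod_map f g = \<langle>f \<cdot> pr1 E (Dom E f) (Dom E g), g \<cdot> pr2 E (Dom E f) (Dom E g)\<rangle>"

definition swap :: "'o \<Rightarrow> 'o \<Rightarrow> 'm" where
  "swap A B = \<langle>pr2 E A B, pr1 E A B\<rangle>"

definition assoc :: "'o \<Rightarrow> 'o \<Rightarrow> 'o \<Rightarrow> 'm" where
  "assoc A B C = \<langle>pr1 E A B \<cdot> pr1 E (A \<times>\<^sub>c B) C,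
     \<langle>pr2 E A B \<cdot> pr1 E (A \<times>\<^sub>c B) C, pr2 E (A \<times>\<^sub>c B) C\<rangle>\<rangle>"

text \<open>The axioms are stated for generalized elements at all stages \<open>J\<close>.\<close>

definition abelian_group_object :: "'o \<Rightarrow> 'm \<Rightarrow> 'm \<Rightarrow> bool" where
  "abelian_group_object A pl z \<longleftrightarrow> A \<in> Obj E \<and> pl \<in> hom E (A \<times>\<^sub>c A) A \<and> z \<in> hom E \<one> A \<and>
     (\<forall>J\<in>Obj E. \<forall>a\<in>hom E J A. \<forall>b\<in>hom E J A. \<forall>c\<in>hom E J A.
        pl \<cdot> \<langle>pl \<cdot> \<langle>a, b\<rangle>, c\<rangle> = pl \<cdot> \<langle>a, pl \<cdot> \<langle>b, c\<rangle>\<rangle>) \<and>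
     (\<forall>J\<in>Obj E. \<forall>a\<in>hom E J A. \<forall>b\<in>hom E J A. pl \<cdot> \<langle>a, b\<rangle> = pl \<cdot> \<langle>b, a\<rangle>) \<and>
     (\<forall>J\<in>Obj E. \<forall>a\<in>hom E J A. pl \<cdot> \<langle>a, z \<cdot> bang J\<rangle> = a) \<and>
     (\<exists>n\<in>hom E A A. \<forall>J\<in>Obj E. \<forall>a\<in>hom E J A. pl \<cdot> \<langle>a, n \<cdot> a\<rangle> = z \<cdot> bang J)"

end

locale cartesian_closed_category_with_coproducts = finite_product_category E
  for E :: "('o, 'm) bccc" (structure) +
  assumes Exp_Obj: "\<lbrakk>A \<in> Obj E; B \<in> Obj E\<rbrakk> \<Longrightarrow> Exp E A B \<in> Obj E"
    and ev_hom: "\<lbrakk>A \<in> Obj E; B \<in> Obj E\<rbrakk> \<Longrightarrow> ev E A B \<in> hom E (Exp E A B \<times>\<^sub>c A) B"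
    and Exp_univ: "\<lbrakk>C \<in> Obj E; A \<in> Obj E; f \<in> hom E (C \<times>\<^sub>c A) B\<rbrakk>
      \<Longrightarrow> \<exists>!h. h \<in> hom E C (Exp E A B) \<and> ev E A B \<cdot> prod_map h (Id E A) = f"
    and Initial: "initial_obj (Initial E)"
    and Coprod_Obj: "\<lbrakk>A \<in> Obj E; B \<in> Obj E\<rbrakk> \<Longrightarrow> A +\<^sub>c B \<in> Obj E"
    and in1_hom: "\<lbrakk>A \<in> Obj E; B \<in> Obj E\<rbrakk> \<Longrightarrow> in1 E A B \<in> hom E A (A +\<^sub>c B)"
    and in2_hom: "\<lbrakk>A \<in> Obj E; B \<in> Obj E\<rbrakk> \<Longrightarrow> in2 E A B \<in> hom E B (A +\<^sub>c B)"
    and Coprod_univ: "\<lbrakk>f \<in> hom E A C; g \<in> hom E B C\<rbrakk>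
      \<Longrightarrow> \<exists>!h. h \<in> hom E (A +\<^sub>c B) C \<and> h \<cdot> in1 E A B = f \<and> h \<cdot> in2 E A B = g"
begin

definition cobang :: "'o \<Rightarrow> 'm" where
  "cobang A = (THE h. h \<in> hom E (Initial E) A)"

definition codiagonal :: "'o \<Rightarrow> 'm" where
  "codiagonal A = (THE h. h \<in> hom E (A +\<^sub>c A) A \<and>
     h \<cdot> in1 E A A = Id E A \<and> h \<cdot> in2 E A A = Id E A)"

definition curry :: "'o \<Rightarrow> 'o \<Rightarrow> 'o \<Rightarrow> 'm \<Rightarrow> 'm" where
  "curry I A B f = (THE h. h \<in> hom E I (Exp E A B) \<and> ev E A B \<cdot> prod_map h (Id E A) = f)"

definition uncurry :: "'o \<Rightarrow> 'o \<Rightarrow> 'm \<Rightarrow> 'm" where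
  "uncurry A B h = ev E A B \<cdot> prod_map h (Id E A)"

end


section \<open>Strong and commutative monads\<close>

text \<open>\<open>str A B\<close> is the tensorial strength from \<open>A \<times>\<^sub>c T B\<close> to \<open>T (A \<times>\<^sub>c B)\<close>.\<close>

record ('o, 'm) str_monad =
  TO :: "'o \<Rightarrow> 'o"
  TA :: "'m \<Rightarrow> 'm"
  eta :: "'o \<Rightarrow> 'm"
  mu :: "'o \<Rightarrow> 'm"
  str :: "'o \<Rightarrow> 'o \<Rightarrow> 'm"

locale strong_monad = cartesian_closed_category_with_coproducts E
  for E :: "('o, 'm) bccc" (structure) +
  fixes T :: "('o, 'm) str_monad"
  assumes TO_Obj: "A \<in> Obj E \<Longrightarrow> TO T A \<in> Obj E"
    and TA_hom: "f \<in> hom E A B \<Longrightarrow> TA T f \<in> hom E (TO T A) (TO T B)"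
    and TA_Id: "A \<in> Obj E \<Longrightarrow> TA T (Id E A) = Id E (TO T A)"
    and TA_Comp: "\<lbrakk>f \<in> hom E A B; g \<in> hom E B C\<rbrakk> \<Longrightarrow> TA T (g \<cdot> f) = TA T g \<cdot> TA T f"
    and eta_hom: "A \<in> Obj E \<Longrightarrow> eta T A \<in> hom E A (TO T A)"
    and eta_nat: "f \<in> hom E A B \<Longrightarrow> TA T f \<cdot> eta T A = eta T B \<cdot> f"
    and mu_hom: "A \<in> Obj E \<Longrightarrow> mu T A \<in> hom E (TO T (TO T A)) (TO T A)"
    and mu_nat: "f \<in> hom E A B \<Longrightarrow> TA T f \<cdot> mu T A = mu T B \<cdot> TA T (TA T f)"
    and mu_eta: "A \<in> Obj E \<Longrightarrow> mu T A \<cdot> eta T (TO T A) = Id E (TO T A)"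
    and mu_T_eta: "A \<in> Obj E \<Longrightarrow> mu T A \<cdot> TA T (eta T A) = Id E (TO T A)"
    and mu_mu: "A \<in> Obj E \<Longrightarrow> mu T A \<cdot> mu T (TO T A) = mu T A \<cdot> TA T (mu T A)"
    and str_hom: "\<lbrakk>A \<in> Obj E; B \<in> Obj E\<rbrakk>
      \<Longrightarrow> str T A B \<in> hom E (A \<times>\<^sub>c TO T B) (TO T (A \<times>\<^sub>c B))"
    and str_nat: "\<lbrakk>f \<in> hom E A A'; g \<in> hom E B B'\<rbrakk>
      \<Longrightarrow> TA T (prod_map f g) \<cdot> str T A B = str T A' B' \<cdot> prod_map f (TA T g)"
    and str_unit: "B \<in> Obj E \<Longrightarrow> TA T (pr2 E \<one> B) \<cdot> str T \<one> B = pr2 E \<one> (TO T B)"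
    and str_assoc: "\<lbrakk>A \<in> Obj E; B \<in> Obj E; C \<in> Obj E\<rbrakk>
      \<Longrightarrow> TA T (assoc A B C) \<cdot> str T (A \<times>\<^sub>c B) C
        = str T A (B \<times>\<^sub>c C) \<cdot> prod_map (Id E A) (str T B C) \<cdot> assoc A B (TO T C)"
    and str_eta: "\<lbrakk>A \<in> Obj E; B \<in> Obj E\<rbrakk>
      \<Longrightarrow> str T A B \<cdot> prod_map (Id E A) (eta T B) = eta T (A \<times>\<^sub>c B)"
    and str_mu: "\<lbrakk>A \<in> Obj E; B \<in> Obj E\<rbrakk>
      \<Longrightarrow> str T A B \<cdot> prod_map (Id E A) (mu T B)
        = mu T (A \<times>\<^sub>c B) \<cdot> TA T (str T A B) \<cdot> str T A (TO T B)"
begin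

text \<open>For a family \<open>f\<close> from \<open>I \<times>\<^sub>c A\<close> to \<open>B\<close>, the arrow \<open>(i, Q) \<mapsto> T(f(i,-))(Q)\<close>
  from \<open>I \<times>\<^sub>c T A\<close> to \<open>T B\<close>.\<close>

definition T_fam :: "'o \<Rightarrow> 'o \<Rightarrow> 'm \<Rightarrow> 'm" where
  "T_fam I A f = TA T f \<cdot> str T I A"

definition str' :: "'o \<Rightarrow> 'o \<Rightarrow> 'm" where
  "str' A B = TA T (swap B A) \<cdot> str T B A \<cdot> swap (TO T A) B"

definition tensor :: "'o \<Rightarrow> 'o \<Rightarrow> 'm" where
  "tensor A B = mu T (A \<times>\<^sub>c B) \<cdot> TA T (str T A B) \<cdot> str' A (TO T B)"

definition T_linear :: "'o \<Rightarrow> 'm \<Rightarrow> 'o \<Rightarrow> 'm \<Rightarrow> 'm \<Rightarrow> bool" where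
  "T_linear A a B b h \<longleftrightarrow> h \<in> hom E A B \<and> h \<cdot> a = b \<cdot> TA T h"

definition prod_alg :: "'o \<Rightarrow> 'm \<Rightarrow> 'o \<Rightarrow> 'm \<Rightarrow> 'm" where
  "prod_alg A a B b = \<langle>a \<cdot> TA T (pr1 E A B), b \<cdot> TA T (pr2 E A B)\<rangle>"

text \<open>\<open>zero_pt Y\<close> is the composite of the iso from \<open>\<one>\<close> to \<open>T(Initial)\<close> (unique when
  \<open>T(Initial)\<close> is terminal) with \<open>T\<close> of the arrow from \<open>Initial\<close> to \<open>Y\<close>.\<close>

definition zero_pt :: "'o \<Rightarrow> 'm" where
  "zero_pt Y = TA T (cobang Y) \<cdot> (THE h. h \<in> hom E \<one> (TO T (Initial E)))"

definition zero_arr :: "'o \<Rightarrow> 'o \<Rightarrow> 'm" where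
  "zero_arr X Y = zero_pt Y \<cdot> bang X"

definition Phi :: "'o \<Rightarrow> 'o \<Rightarrow> 'm" where
  "Phi X Y = (THE h.
     T_linear (TO T (X +\<^sub>c Y)) (mu T (X +\<^sub>c Y))
       (TO T X \<times>\<^sub>c TO T Y) (prod_alg (TO T X) (mu T X) (TO T Y) (mu T Y)) h \<and>
     h \<cdot> eta T (X +\<^sub>c Y) \<cdot> in1 E X Y = \<langle>eta T X, zero_arr X Y\<rangle> \<and>
     h \<cdot> eta T (X +\<^sub>c Y) \<cdot> in2 E X Y = \<langle>zero_arr Y X, eta T Y\<rangle>)"

definition add :: "'o \<Rightarrow> 'm" where
  "add X = TA T (codiagonal X) \<cdot> inv_arr (Phi X X)"

definition neg :: "'o \<Rightarrow> 'm" where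
  "neg X = (THE n. n \<in> hom E (TO T X) (TO T X) \<and>
     (\<forall>J\<in>Obj E. \<forall>a\<in>hom E J (TO T X). add X \<cdot> \<langle>a, n \<cdot> a\<rangle> = zero_pt X \<cdot> bang J))"

text \<open>The ring \<open>R\<close>; its multiplication is the case \<open>X = \<one>\<close> of the following action
  on \<open>TO T X\<close>.\<close>

abbreviation R :: 'o where
  "R \<equiv> TO T \<one>"

definition smult :: "'o \<Rightarrow> 'm" where
  "smult X = TA T (pr2 E \<one> X) \<cdot> tensor \<one> X"

text \<open>The pairing of \<open>P \<in> hom E I (TO T Y)\<close> and \<open>\<phi> \<in> hom E I (Exp E Y B)\<close>
  with values in a \<open>T\<close>-algebra \<open>(B, \<beta>)\<close>, as an element of \<open>B\<close> at stage \<open>I\<close>.\<close>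

definition pairing :: "'o \<Rightarrow> 'o \<Rightarrow> 'm \<Rightarrow> 'm \<Rightarrow> 'm \<Rightarrow> 'm" where
  "pairing Y B \<beta> P \<phi> = \<beta> \<cdot> T_fam (Exp E Y B) Y (ev E Y B) \<cdot> \<langle>\<phi>, P\<rangle>"

text \<open>\<open>translate u Q\<close> is \<open>T(x \<mapsto> x + u)(Q)\<close> for elements \<open>u\<close> of \<open>R\<close> and
  \<open>Q\<close> of \<open>TO T R\<close> at a common stage.\<close>

definition translate :: "'m \<Rightarrow> 'm \<Rightarrow> 'm" where
  "translate u Q = T_fam R R (add \<one> \<cdot> \<langle>pr2 E R R, pr1 E R R\<rangle>) \<cdot> \<langle>u, Q\<rangle>"

text \<open>\<open>f'\<close> is a derivative of \<open>f\<close>, both from \<open>I \<times>\<^sub>c R\<close> to \<open>V\<close>, where \<open>pl\<close> and \<open>sm\<close>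
  are the addition and scalar multiplication of \<open>V\<close>, and \<open>\<iota>\<close> includes \<open>D\<close> into \<open>R\<close>.\<close>

definition is_derivative ::
  "'o \<Rightarrow> 'm \<Rightarrow> 'o \<Rightarrow> 'm \<Rightarrow> 'm \<Rightarrow> 'o \<Rightarrow> 'm \<Rightarrow> 'm \<Rightarrow> bool" where
  "is_derivative D \<iota> V pl sm I f f' \<longleftrightarrow> f' \<in> hom E (I \<times>\<^sub>c R) V \<and>
     (\<forall>J\<in>Obj E. \<forall>i\<in>hom E J I. \<forall>x\<in>hom E J R. \<forall>d\<in>hom E J D.
        f \<cdot> \<langle>i, add \<one> \<cdot> \<langle>x, \<iota> \<cdot> d\<rangle>\<rangle>
          = pl \<cdot> \<langle>f \<cdot> \<langle>i, x\<rangle>, sm \<cdot> \<langle>\<iota> \<cdot> d, f' \<cdot> \<langle>i, x\<rangle>\<rangle>\<rangle>)"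

definition KL :: "'o \<Rightarrow> 'm \<Rightarrow> 'o \<Rightarrow> 'm \<Rightarrow> 'm \<Rightarrow> bool" where
  "KL D \<iota> V pl sm \<longleftrightarrow>
     (\<forall>I\<in>Obj E. \<forall>f\<in>hom E (I \<times>\<^sub>c R) V. \<exists>!f'. is_derivative D \<iota> V pl sm I f f')"

text \<open>The derivative of an element \<open>\<phi>\<close> of \<open>Exp E R (TO T X)\<close> at stage \<open>I\<close>.\<close>

definition fun_deriv :: "'o \<Rightarrow> 'm \<Rightarrow> 'o \<Rightarrow> 'o \<Rightarrow> 'm \<Rightarrow> 'm" where
  "fun_deriv D \<iota> X I \<phi> = curry I R (TO T X)
     (THE f'. is_derivative D \<iota> (TO T X) (add X) (smult X) I (uncurry R (TO T X) \<phi>) f')"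

text \<open>The derivative of an element \<open>P\<close> of \<open>TO T R\<close> at stage \<open>I\<close>.\<close>

definition dist_deriv :: "'o \<Rightarrow> 'm \<Rightarrow> 'o \<Rightarrow> 'm \<Rightarrow> 'm" where
  "dist_deriv D \<iota> I P = (THE P'. P' \<in> hom E I (TO T R) \<and>
     (\<forall>J\<in>Obj E. \<forall>i\<in>hom E J I. \<forall>d\<in>hom E J D.
        smult R \<cdot> \<langle>\<iota> \<cdot> d, P' \<cdot> i\<rangle>
          = add R \<cdot> \<langle>P \<cdot> i, neg R \<cdot> translate (\<iota> \<cdot> d) (P \<cdot> i)\<rangle>))"

end

locale commutative_monad = strong_monad E T
  for E :: "('o, 'm) bccc" (structure) and T :: "('o, 'm) str_monad" +
  assumes commutative: "\<lbrakk>A \<in> Obj E; B \<in> Obj E\<rbrakk>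
    \<Longrightarrow> mu T (A \<times>\<^sub>c B) \<cdot> TA T (str T A B) \<cdot> str' A (TO T B)
      = mu T (A \<times>\<^sub>c B) \<cdot> TA T (str' A B) \<cdot> str T (TO T A) B"

locale additive_monad = commutative_monad E T
  for E :: "('o, 'm) bccc" (structure) and T :: "('o, 'm) str_monad" +
  assumes T_Initial: "terminal_obj (TO T (Initial E))"
    and Phi_iso: "\<lbrakk>A \<in> Obj E; B \<in> Obj E\<rbrakk> \<Longrightarrow> iso_arr (Phi A B)"
    and abelian_group: "A \<in> Obj E \<Longrightarrow> abelian_group_object (TO T A) (add A) (zero_pt A)"

locale KL_monad = additive_monad E T
  for E :: "('o, 'm) bccc" (structure) and T :: "('o, 'm) str_monad" +
  fixes D :: 'o and \<iota> :: 'm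
  assumes subobject: "\<iota> \<in> hom E D R" "mono_arr \<iota>"
    and KL_ring: "KL D \<iota> R (add \<one>) (smult \<one>)"
    and KL_module: "A \<in> Obj E \<Longrightarrow> KL D \<iota> (TO T A) (add A) (smult A)"

end

(*
  For d in D, bilinearity of the pairing and of the scalar multiplication gives
    d.<P', phi> + <alpha^d_* P, phi> = <d.P' + alpha^d_* P, phi> = <P, phi>,
  while
    <alpha^d_* P, phi> = <P, phi o alpha^d> = <P, phi + d.phi'> = <P, phi> + d.<P, phi'>.
  Hence d.<P', phi> = d.(-<P, phi'>) for all d, and the universally quantified d cancels by
  KL uniqueness.  Commutativity of the monad enters only through <P, d.phi'> = d.<P, phi'>.
*)

theory Submission
  imports Defs
begin

text \<open>Addition on \<open>TO T X\<close> is defined through the inverse of \<open>Phi\<close>,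
  scalar multiplication through \<open>tensor\<close>, and both must be traced back to the monad
  structure. The common language is Kleisli extension with a parameter: pairing, translation and
  scalar action are all instances of \<open>bind\<close>, so most identities become its unit and
  associativity laws. Statements about elements are statements at every stage J, so integrands are
  families on a product of J with A. The hard case is additivity in the element being integrated: it
  compares families on the product of J with A + A, and needs products with J to respect coproducts.
  This is not assumed but follows from the existence of exponentials. Additivity in the integrand is
  easier, since there \<open>Phi\<close> is inverted at the larger stage and everything passes
  through one extension. Both derivatives are given by descriptions, so existence must be
  established as well; for P' it comes from KL for \<open>TO T R\<close>, applied to the family of
  all translates of P.\<close>

section \<open>Arrows, composition and inverses\<close>

context category
begin

text \<open>Turns typing into equations on \<open>Dom\<close> and \<open>Cod\<close>, which
  rewriting can compute for compound arrows; the hom-set form is kept for rules used by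
  resolution.\<close>

lemma hom_iff: "f \<in> hom E A B \<longleftrightarrow> f \<in> Arr E \<and> Dom E f = A \<and> Cod E f = B"
  by (auto simp: hom_def)

lemma Dom_in_Obj [simp]: "f \<in> Arr E \<Longrightarrow> Dom E f \<in> Obj E"
  by (rule Dom_Obj)

lemma Cod_in_Obj [simp]: "f \<in> Arr E \<Longrightarrow> Cod E f \<in> Obj E"
  by (rule Cod_Obj)

lemma hom_Obj: "f \<in> hom E A B \<Longrightarrow> A \<in> Obj E" "f \<in> hom E A B \<Longrightarrow> B \<in> Obj E"
  by (auto simp: hom_iff)

lemma Id_simps [simp]:
  "A \<in> Obj E \<Longrightarrow> Id E A \<in> Arr E" "A \<in> Obj E \<Longrightarrow> Dom E (Id E A) = A"
  "A \<in> Obj E \<Longrightarrow> Cod E (Id E A) = A"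
  using Id_hom by (auto simp: hom_iff)

lemma Comp_simps [simp]:
  assumes "f \<in> Arr E" "g \<in> Arr E" "Dom E g = Cod E f"
  shows "g \<cdot> f \<in> Arr E" "Dom E (g \<cdot> f) = Dom E f" "Cod E (g \<cdot> f) = Cod E g"
  using Comp_hom[of f "Dom E f" "Cod E f" g "Cod E g"] assms by (auto simp: hom_iff)

lemma Comp_Id_right [simp]: "\<lbrakk>f \<in> Arr E; Dom E f = A\<rbrakk> \<Longrightarrow> f \<cdot> Id E A = f"
  using Comp_Id[of f A "Cod E f"] by (simp add: hom_iff)

lemma Comp_Id_left [simp]: "\<lbrakk>f \<in> Arr E; Cod E f = A\<rbrakk> \<Longrightarrow> Id E A \<cdot> f = f"
  using Id_Comp[of f "Dom E f" A] by (simp add: hom_iff)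

lemma Comp_assoc_right [simp]:
  "\<lbrakk>f \<in> Arr E; g \<in> Arr E; h \<in> Arr E; Dom E g = Cod E f; Dom E h = Cod E g\<rbrakk>
    \<Longrightarrow> (h \<cdot> g) \<cdot> f = h \<cdot> g \<cdot> f"
  using Comp_assoc[of f "Dom E f" "Cod E f" g "Cod E g" h "Cod E h"] by (simp add: hom_iff)

text \<open>Once composites are nested to the right, an equation for \<open>h \<cdot> g\<close> no
  longer matches when a further arrow follows; this form does.\<close>

lemma Comp_reassoc:
  "\<lbrakk>h \<cdot> g = k; f \<in> Arr E; g \<in> Arr E; h \<in> Arr E; Dom E g = Cod E f; Dom E h = Cod E g\<rbrakk>
    \<Longrightarrow> h \<cdot> g \<cdot> f = k \<cdot> f"
  using Comp_assoc_right by metis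

lemma inverse_arr_unique:
  assumes "inverse_arr f g" "inverse_arr f h"
  shows "g = h"
proof -
  have "g = (h \<cdot> f) \<cdot> g"
    using assms by (simp add: inverse_arr_def hom_iff)
  also have "\<dots> = h \<cdot> f \<cdot> g"
    using assms by (subst Comp_assoc_right) (simp_all add: inverse_arr_def hom_iff)
  also have "\<dots> = h"
    using assms by (simp add: inverse_arr_def hom_iff)
  finally show ?thesis .
qed

lemma inverse_arr_inv_arr: "iso_arr f \<Longrightarrow> inverse_arr f (inv_arr f)"
  unfolding iso_arr_def inv_arr_def by (metis inverse_arr_unique theI)

end

section \<open>Terminal object and binary products\<close>

context finite_product_category
begin

lemma Terminal_Obj [simp]: "\<one> \<in> Obj E"
  using Terminal by (simp add: terminal_obj_def)

lemma bang_hom: "A \<in> Obj E \<Longrightarrow> bang A \<in> hom E A \<one>"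
  unfolding bang_def by (rule theI') (use Terminal in \<open>simp add: terminal_obj_def\<close>)

lemma bang_simps [simp]:
  "A \<in> Obj E \<Longrightarrow> bang A \<in> Arr E" "A \<in> Obj E \<Longrightarrow> Dom E (bang A) = A"
  "A \<in> Obj E \<Longrightarrow> Cod E (bang A) = \<one>"
  using bang_hom by (auto simp: hom_iff)

lemma bang_unique: "f \<in> Arr E \<Longrightarrow> Cod E f = \<one> \<Longrightarrow> f = bang (Dom E f)"
  using Terminal bang_hom[of "Dom E f"] hom_iff[of f "Dom E f" \<one>] Dom_Obj[of f]
  unfolding terminal_obj_def by blast

lemma bang_comp [simp]: "f \<in> Arr E \<Longrightarrow> Cod E f = A \<Longrightarrow> bang A \<cdot> f = bang (Dom E f)"
  using bang_unique[of "bang A \<cdot> f"] by auto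

lemma Prod_in_Obj [simp]: "A \<in> Obj E \<Longrightarrow> B \<in> Obj E \<Longrightarrow> A \<times>\<^sub>c B \<in> Obj E"
  by (rule Prod_Obj)

lemma pr_simps [simp]:
  assumes "A \<in> Obj E" "B \<in> Obj E"
  shows "pr1 E A B \<in> Arr E" "Dom E (pr1 E A B) = A \<times>\<^sub>c B" "Cod E (pr1 E A B) = A"
    "pr2 E A B \<in> Arr E" "Dom E (pr2 E A B) = A \<times>\<^sub>c B" "Cod E (pr2 E A B) = B"
  using pr1_hom[OF assms] pr2_hom[OF assms] by (auto simp: hom_iff)

lemma pair_props:
  assumes "f \<in> Arr E" "g \<in> Arr E" "Dom E f = Dom E g"
  shows "\<langle>f, g\<rangle> \<in> hom E (Dom E f) (Cod E f \<times>\<^sub>c Cod E g) \<and>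
     pr1 E (Cod E f) (Cod E g) \<cdot> \<langle>f, g\<rangle> = f \<and> pr2 E (Cod E f) (Cod E g) \<cdot> \<langle>f, g\<rangle> = g"
  unfolding pair_def
  by (rule theI'[OF Prod_univ]) (use assms in \<open>auto simp: hom_iff\<close>)

lemma pair_simps [simp]:
  assumes "f \<in> Arr E" "g \<in> Arr E" "Dom E f = Dom E g"
  shows "\<langle>f, g\<rangle> \<in> Arr E" "Dom E \<langle>f, g\<rangle> = Dom E g" "Cod E \<langle>f, g\<rangle> = Cod E f \<times>\<^sub>c Cod E g"
  using pair_props[OF assms] assms by (auto simp: hom_iff)

lemma pr_pair [simp]:
  assumes "f \<in> Arr E" "g \<in> Arr E" "Dom E f = Dom E g" "Cod E f = A" "Cod E g = B"
  shows "pr1 E A B \<cdot> \<langle>f, g\<rangle> = f" "pr2 E A B \<cdot> \<langle>f, g\<rangle> = g"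
  using pair_props[OF assms(1-3)] assms(4,5) by auto

lemma pair_eqI:
  assumes "h \<in> Arr E" "k \<in> Arr E" "Dom E h = Dom E k" "Cod E h = A \<times>\<^sub>c B" "Cod E k = A \<times>\<^sub>c B"
    and "A \<in> Obj E" "B \<in> Obj E"
    and "pr1 E A B \<cdot> h = pr1 E A B \<cdot> k" "pr2 E A B \<cdot> h = pr2 E A B \<cdot> k"
  shows "h = k"
proof -
  have "\<exists>!l. l \<in> hom E (Dom E k) (A \<times>\<^sub>c B) \<and> pr1 E A B \<cdot> l = pr1 E A B \<cdot> k \<and>
      pr2 E A B \<cdot> l = pr2 E A B \<cdot> k"
    by (rule Prod_univ) (use assms in \<open>auto simp: hom_iff\<close>)
  moreover have "h \<in> hom E (Dom E k) (A \<times>\<^sub>c B)" "k \<in> hom E (Dom E k) (A \<times>\<^sub>c B)"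
    using assms by (simp_all add: hom_iff)
  ultimately show ?thesis
    using assms(8,9) by blast
qed

lemma pair_comp [simp]:
  assumes "f \<in> Arr E" "g \<in> Arr E" "h \<in> Arr E" "Dom E f = Cod E h" "Dom E g = Cod E h"
  shows "\<langle>f, g\<rangle> \<cdot> h = \<langle>f \<cdot> h, g \<cdot> h\<rangle>"
proof (rule pair_eqI[where A = "Cod E f" and B = "Cod E g"])
  show "pr1 E (Cod E f) (Cod E g) \<cdot> \<langle>f, g\<rangle> \<cdot> h = pr1 E (Cod E f) (Cod E g) \<cdot> \<langle>f \<cdot> h, g \<cdot> h\<rangle>"
    using assms by (subst Comp_assoc_right[symmetric]) simp_all
  show "pr2 E (Cod E f) (Cod E g) \<cdot> \<langle>f, g\<rangle> \<cdot> h = pr2 E (Cod E f) (Cod E g) \<cdot> \<langle>f \<cdot> h, g \<cdot> h\<rangle>"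
    using assms by (subst Comp_assoc_right[symmetric]) simp_all
qed (use assms in simp_all)

lemma pair_eta [simp]:
  "\<lbrakk>h \<in> Arr E; Cod E h = A \<times>\<^sub>c B; A \<in> Obj E; B \<in> Obj E\<rbrakk>
    \<Longrightarrow> \<langle>pr1 E A B \<cdot> h, pr2 E A B \<cdot> h\<rangle> = h"
  by (rule pair_eqI[where A = A and B = B]) simp_all

lemma pair_pr [simp]: "\<lbrakk>A \<in> Obj E; B \<in> Obj E\<rbrakk> \<Longrightarrow> \<langle>pr1 E A B, pr2 E A B\<rangle> = Id E (A \<times>\<^sub>c B)"
  using pair_eta[of "Id E (A \<times>\<^sub>c B)" A B] by simp

end

section \<open>Exponentials, coproducts, and products over coproducts\<close>

context cartesian_closed_category_with_coproducts
begin

lemma Exp_in_Obj [simp]: "A \<in> Obj E \<Longrightarrow> B \<in> Obj E \<Longrightarrow> Exp E A B \<in> Obj E"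
  by (rule Exp_Obj)

lemma ev_simps [simp]:
  assumes "A \<in> Obj E" "B \<in> Obj E"
  shows "ev E A B \<in> Arr E" "Dom E (ev E A B) = Exp E A B \<times>\<^sub>c A" "Cod E (ev E A B) = B"
  using ev_hom[OF assms] by (auto simp: hom_iff)

lemma uncurry_hom: "\<lbrakk>h \<in> hom E I (Exp E A B); A \<in> Obj E; B \<in> Obj E\<rbrakk>
    \<Longrightarrow> uncurry A B h \<in> hom E (I \<times>\<^sub>c A) B"
  by (auto simp: uncurry_def prod_map_def hom_iff)

lemma curry_props:
  assumes "I \<in> Obj E" "A \<in> Obj E" "f \<in> hom E (I \<times>\<^sub>c A) B"
  shows "curry I A B f \<in> hom E I (Exp E A B)" "uncurry A B (curry I A B f) = f"
proof -
  have "curry I A B f \<in> hom E I (Exp E A B) \<and> ev E A B \<cdot> prod_map (curry I A B f) (Id E A) = f"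
    unfolding curry_def by (rule theI'[OF Exp_univ[OF assms]])
  then show "curry I A B f \<in> hom E I (Exp E A B)" "uncurry A B (curry I A B f) = f"
    by (auto simp: uncurry_def)
qed

lemma uncurry_comp:
  assumes "h \<in> hom E J (Exp E A B)" "u \<in> hom E K J" "A \<in> Obj E" "B \<in> Obj E"
  shows "uncurry A B (h \<cdot> u) = uncurry A B h \<cdot> \<langle>u \<cdot> pr1 E K A, pr2 E K A\<rangle>"
proof -
  have [simp]: "K \<in> Obj E" "J \<in> Obj E" using assms by (auto simp: hom_iff)
  show ?thesis
    using assms by (simp add: uncurry_def prod_map_def hom_iff)
qed

lemma uncurry_inj:
  assumes "h \<in> hom E I (Exp E A B)" "k \<in> hom E I (Exp E A B)" "A \<in> Obj E" "B \<in> Obj E"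
    and "uncurry A B h = uncurry A B k"
  shows "h = k"
proof -
  have [simp]: "I \<in> Obj E" using assms by (auto simp: hom_iff)
  have "\<exists>!l. l \<in> hom E I (Exp E A B) \<and> ev E A B \<cdot> prod_map l (Id E A) = uncurry A B k"
    by (rule Exp_univ) (use assms uncurry_hom in auto)
  then show ?thesis
    using assms(1,2,5) unfolding uncurry_def by blast
qed

lemma Initial_Obj [simp]: "Initial E \<in> Obj E"
  using Initial by (simp add: initial_obj_def)

lemma Initial_unique: "\<lbrakk>f \<in> hom E (Initial E) A; g \<in> hom E (Initial E) A\<rbrakk> \<Longrightarrow> f = g"
  using Initial hom_Obj(2)[of f "Initial E" A] unfolding initial_obj_def by blast

lemma cobang_hom: "A \<in> Obj E \<Longrightarrow> cobang A \<in> hom E (Initial E) A"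
  unfolding cobang_def by (rule theI') (use Initial in \<open>simp add: initial_obj_def\<close>)

lemma cobang_simps [simp]:
  "A \<in> Obj E \<Longrightarrow> cobang A \<in> Arr E" "A \<in> Obj E \<Longrightarrow> Dom E (cobang A) = Initial E"
  "A \<in> Obj E \<Longrightarrow> Cod E (cobang A) = A"
  using cobang_hom by (auto simp: hom_iff)

lemma Coprod_in_Obj [simp]: "A \<in> Obj E \<Longrightarrow> B \<in> Obj E \<Longrightarrow> A +\<^sub>c B \<in> Obj E"
  by (rule Coprod_Obj)

lemma in_simps [simp]:
  assumes "A \<in> Obj E" "B \<in> Obj E"
  shows "in1 E A B \<in> Arr E" "Dom E (in1 E A B) = A" "Cod E (in1 E A B) = A +\<^sub>c B"
    "in2 E A B \<in> Arr E" "Dom E (in2 E A B) = B" "Cod E (in2 E A B) = A +\<^sub>c B"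
  using in1_hom[OF assms] in2_hom[OF assms] by (auto simp: hom_iff)

lemma Coprod_eqI:
  assumes "h \<in> hom E (A +\<^sub>c B) C" "k \<in> hom E (A +\<^sub>c B) C" "A \<in> Obj E" "B \<in> Obj E"
    and "h \<cdot> in1 E A B = k \<cdot> in1 E A B" "h \<cdot> in2 E A B = k \<cdot> in2 E A B"
  shows "h = k"
proof -
  have "\<exists>!l. l \<in> hom E (A +\<^sub>c B) C \<and> l \<cdot> in1 E A B = k \<cdot> in1 E A B \<and>
      l \<cdot> in2 E A B = k \<cdot> in2 E A B"
    by (rule Coprod_univ) (use assms in \<open>auto simp: hom_iff\<close>)
  then show ?thesis
    using assms by blast
qed

lemma codiagonal_props:
  assumes "A \<in> Obj E"
  shows "codiagonal A \<in> hom E (A +\<^sub>c A) A" "codiagonal A \<cdot> in1 E A A = Id E A"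
    "codiagonal A \<cdot> in2 E A A = Id E A"
  using theI'[OF Coprod_univ[OF Id_hom Id_hom, OF assms assms], folded codiagonal_def] by auto

lemma codiagonal_simps [simp]:
  assumes "A \<in> Obj E"
  shows "codiagonal A \<in> Arr E" "Dom E (codiagonal A) = A +\<^sub>c A" "Cod E (codiagonal A) = A"
  using codiagonal_props[OF assms] by (auto simp: hom_iff)

definition copair :: "'o \<Rightarrow> 'o \<Rightarrow> 'm \<Rightarrow> 'm \<Rightarrow> 'm" where
  "copair A B f g = (THE h. h \<in> hom E (A +\<^sub>c B) (Cod E f) \<and> h \<cdot> in1 E A B = f \<and> h \<cdot> in2 E A B = g)"

lemma copair_props:
  assumes "f \<in> hom E A C" "g \<in> hom E B C"
  shows "copair A B f g \<in> hom E (A +\<^sub>c B) C" "copair A B f g \<cdot> in1 E A B = f"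
    "copair A B f g \<cdot> in2 E A B = g"
  using theI'[OF Coprod_univ[OF assms]] assms(1) by (simp_all add: copair_def hom_iff)

text \<open>Currying turns arrows out of \<open>J \<times>\<^sub>c S\<close> into arrows out of \<open>S\<close>, so that a product with
  a fixed factor preserves the universal properties of \<open>S\<close> on the uniqueness side.\<close>

definition transpose :: "'o \<Rightarrow> 'o \<Rightarrow> 'o \<Rightarrow> 'm \<Rightarrow> 'm" where
  "transpose J S C f = curry S J C (f \<cdot> swap S J)"

lemma transpose_hom:
  "\<lbrakk>f \<in> hom E (J \<times>\<^sub>c S) C; J \<in> Obj E; S \<in> Obj E\<rbrakk> \<Longrightarrow> transpose J S C f \<in> hom E S (Exp E J C)"
  unfolding transpose_def by (rule curry_props) (auto simp: swap_def hom_iff)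

text \<open>Naturality of currying. The factors come out exchanged because \<open>uncurry\<close>
  places the argument of the exponential last.\<close>

lemma uncurry_transpose_comp:
  assumes "f \<in> hom E (J \<times>\<^sub>c S) C" "J \<in> Obj E" "u \<in> hom E A S"
  shows "uncurry J C (transpose J S C f \<cdot> u) = f \<cdot> \<langle>pr2 E A J, u \<cdot> pr1 E A J\<rangle>"
proof -
  have o[simp]: "S \<in> Obj E" "A \<in> Obj E" "C \<in> Obj E" using assms by (auto simp: hom_iff)
  have "f \<cdot> swap S J \<in> hom E (S \<times>\<^sub>c J) C"
    using assms by (auto simp: swap_def hom_iff)
  then show ?thesis
    using assms transpose_hom[OF assms(1,2) o(1)]
    by (simp add: uncurry_comp[of _ S _ _ u A] curry_props(2) transpose_def)
      (simp add: swap_def hom_iff)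
qed

lemma transpose_comp_eqI:
  assumes "f \<in> hom E (J \<times>\<^sub>c S) C" "g \<in> hom E (J \<times>\<^sub>c S) C" "J \<in> Obj E" "u \<in> hom E A S"
    and "f \<cdot> \<langle>pr1 E J A, u \<cdot> pr2 E J A\<rangle> = g \<cdot> \<langle>pr1 E J A, u \<cdot> pr2 E J A\<rangle>"
  shows "transpose J S C f \<cdot> u = transpose J S C g \<cdot> u"
proof -
  have o[simp]: "S \<in> Obj E" "A \<in> Obj E" "C \<in> Obj E" using assms by (auto simp: hom_iff)
  have sw: "h \<cdot> \<langle>pr2 E A J, u \<cdot> pr1 E A J\<rangle> = (h \<cdot> \<langle>pr1 E J A, u \<cdot> pr2 E J A\<rangle>) \<cdot> swap A J"
    if "h \<in> hom E (J \<times>\<^sub>c S) C" for h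
    using that assms by (simp add: swap_def hom_iff)
  show ?thesis
  proof (rule uncurry_inj)
    show "uncurry J C (transpose J S C f \<cdot> u) = uncurry J C (transpose J S C g \<cdot> u)"
      using assms by (simp add: uncurry_transpose_comp sw)
    show "transpose J S C f \<cdot> u \<in> hom E A (Exp E J C)" "transpose J S C g \<cdot> u \<in> hom E A (Exp E J C)"
      by (rule Comp_hom[OF assms(4) transpose_hom], use assms in auto)+
  qed (use assms in auto)
qed

lemma transpose_inj:
  assumes "f \<in> hom E (J \<times>\<^sub>c S) C" "g \<in> hom E (J \<times>\<^sub>c S) C" "J \<in> Obj E" "S \<in> Obj E"
    and "transpose J S C f = transpose J S C g"
  shows "f = g"
proof -
  have [simp]: "C \<in> Obj E" using assms by (auto simp: hom_iff)
  have *: "h = uncurry J C (transpose J S C h \<cdot> Id E S) \<cdot> swap J S"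
    if "h \<in> hom E (J \<times>\<^sub>c S) C" for h
    using that assms by (subst uncurry_transpose_comp) (auto simp: hom_iff swap_def)
  show ?thesis
    using *[OF assms(1)] *[OF assms(2)] assms(5) by simp
qed

text \<open>The product with J has a right adjoint, so it preserves coproducts. Only the uniqueness
  half is needed: the two injections stay jointly epic after taking the product with J.\<close>

lemma Prod_Coprod_eqI:
  assumes "f \<in> hom E (J \<times>\<^sub>c (A +\<^sub>c B)) C" "g \<in> hom E (J \<times>\<^sub>c (A +\<^sub>c B)) C"
    and "J \<in> Obj E" "A \<in> Obj E" "B \<in> Obj E"
    and "f \<cdot> \<langle>pr1 E J A, in1 E A B \<cdot> pr2 E J A\<rangle> = g \<cdot> \<langle>pr1 E J A, in1 E A B \<cdot> pr2 E J A\<rangle>"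
    and "f \<cdot> \<langle>pr1 E J B, in2 E A B \<cdot> pr2 E J B\<rangle> = g \<cdot> \<langle>pr1 E J B, in2 E A B \<cdot> pr2 E J B\<rangle>"
  shows "f = g"
proof (rule transpose_inj)
  show "transpose J (A +\<^sub>c B) C f = transpose J (A +\<^sub>c B) C g"
  proof (rule Coprod_eqI[where C = "Exp E J C"])
    show "transpose J (A +\<^sub>c B) C f \<cdot> in1 E A B = transpose J (A +\<^sub>c B) C g \<cdot> in1 E A B"
      by (rule transpose_comp_eqI) (use assms in1_hom in auto)
    show "transpose J (A +\<^sub>c B) C f \<cdot> in2 E A B = transpose J (A +\<^sub>c B) C g \<cdot> in2 E A B"
      by (rule transpose_comp_eqI) (use assms in2_hom in auto)
  qed (use assms transpose_hom in auto)
qed (use assms in auto)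

text \<open>The nullary case of the same principle: transposes are arrows out of the initial
  object.\<close>

lemma Prod_Initial_unique:
  assumes "f \<in> hom E (J \<times>\<^sub>c Initial E) C" "g \<in> hom E (J \<times>\<^sub>c Initial E) C" "J \<in> Obj E"
  shows "f = g"
  by (rule transpose_inj[OF assms Initial_Obj])
    (rule Initial_unique[OF transpose_hom transpose_hom], use assms in auto)

end

section \<open>Kleisli extension with parameters\<close>

context strong_monad
begin

lemma TO_in_Obj [simp]: "A \<in> Obj E \<Longrightarrow> TO T A \<in> Obj E"
  by (rule TO_Obj)

lemma TA_simps [simp]:
  assumes "f \<in> Arr E"
  shows "TA T f \<in> Arr E" "Dom E (TA T f) = TO T (Dom E f)" "Cod E (TA T f) = TO T (Cod E f)"
  using TA_hom[of f "Dom E f" "Cod E f"] assms by (auto simp: hom_iff)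

lemma unit_simps [simp]:
  assumes "A \<in> Obj E"
  shows "eta T A \<in> Arr E" "Dom E (eta T A) = A" "Cod E (eta T A) = TO T A"
    "mu T A \<in> Arr E" "Dom E (mu T A) = TO T (TO T A)" "Cod E (mu T A) = TO T A"
  using eta_hom[OF assms] mu_hom[OF assms] by (auto simp: hom_iff)

lemma str_simps [simp]:
  assumes "A \<in> Obj E" "B \<in> Obj E"
  shows "str T A B \<in> Arr E" "Dom E (str T A B) = A \<times>\<^sub>c TO T B"
    "Cod E (str T A B) = TO T (A \<times>\<^sub>c B)"
  using str_hom[OF assms] by (auto simp: hom_iff)

lemma TA_Comp_Arr: "\<lbrakk>f \<in> Arr E; g \<in> Arr E; Dom E g = Cod E f\<rbrakk> \<Longrightarrow> TA T (g \<cdot> f) = TA T g \<cdot> TA T f"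
  using TA_Comp[of f "Dom E f" "Cod E f" g "Cod E g"] by (simp add: hom_iff)

lemma TA_Comp_Comp:
  "\<lbrakk>f \<in> Arr E; g \<in> Arr E; h \<in> Arr E; Dom E g = Cod E f; Cod E h = TO T (Dom E f)\<rbrakk>
    \<Longrightarrow> TA T g \<cdot> TA T f \<cdot> h = TA T (g \<cdot> f) \<cdot> h"
  by (simp add: TA_Comp_Arr)

lemma mu_nat_Comp:
  "\<lbrakk>f \<in> Arr E; Dom E f = A; h \<in> Arr E; Cod E h = TO T (TO T A)\<rbrakk>
    \<Longrightarrow> TA T f \<cdot> mu T A \<cdot> h = mu T (Cod E f) \<cdot> TA T (TA T f) \<cdot> h"
  using mu_nat[of f A "Cod E f"] Dom_Obj[of f]
  by (subst Comp_reassoc) (auto simp: hom_iff)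

text \<open>Naturality of the strength in both arguments reduces each of its uses to the generic
  one, where the parameter is the identity of the stage.\<close>

lemma str_pair:
  assumes "x \<in> Arr E" "P \<in> Arr E" "Dom E x = Dom E P" "g \<in> Arr E" "Cod E P = TO T (Dom E g)"
  shows "str T (Cod E x) (Cod E g) \<cdot> \<langle>x, TA T g \<cdot> P\<rangle>
    = TA T \<langle>x \<cdot> pr1 E (Dom E P) (Dom E g), g \<cdot> pr2 E (Dom E P) (Dom E g)\<rangle>
        \<cdot> str T (Dom E P) (Dom E g) \<cdot> \<langle>Id E (Dom E P), P\<rangle>"
proof -
  have "(TA T (prod_map x g) \<cdot> str T (Dom E P) (Dom E g)) \<cdot> \<langle>Id E (Dom E P), P\<rangle>
      = (str T (Cod E x) (Cod E g) \<cdot> prod_map x (TA T g)) \<cdot> \<langle>Id E (Dom E P), P\<rangle>"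
    using assms by (subst str_nat[of x "Dom E P" "Cod E x" g "Dom E g" "Cod E g"]) (simp_all add: hom_iff)
  then show ?thesis
    using assms by (simp add: prod_map_def)
qed

lemma str_pair_Id:
  assumes "x \<in> Arr E" "P \<in> Arr E" "Dom E x = Dom E P" "Cod E P = TO T A" "A \<in> Obj E"
  shows "str T (Cod E x) A \<cdot> \<langle>x, P\<rangle>
    = TA T \<langle>x \<cdot> pr1 E (Dom E P) A, pr2 E (Dom E P) A\<rangle>
        \<cdot> str T (Dom E P) A \<cdot> \<langle>Id E (Dom E P), P\<rangle>"
  using str_pair[of x P "Id E A"] assms by (simp add: TA_Id)

text \<open>Kleisli extension at stage \<open>J\<close>: for a family \<open>f\<close> from \<open>J \<times>\<^sub>c A\<close> to \<open>T B\<close> and \<open>P\<close> from \<open>J\<close>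
  to \<open>T A\<close>, \<open>bind A B f P\<close> is \<open>j \<mapsto> \<mu>(T(f(j,-))(P(j)))\<close>.  Pairing, translation and scalar
  multiplication are all of this form.\<close>

definition bind :: "'o \<Rightarrow> 'o \<Rightarrow> 'm \<Rightarrow> 'm \<Rightarrow> 'm" where
  "bind A B f P = mu T B \<cdot> TA T f \<cdot> str T (Dom E P) A \<cdot> \<langle>Id E (Dom E P), P\<rangle>"

lemma bind_hom:
  assumes "P \<in> hom E J (TO T A)" "f \<in> hom E (J \<times>\<^sub>c A) (TO T B)" "A \<in> Obj E" "B \<in> Obj E"
  shows "bind A B f P \<in> hom E J (TO T B)"
proof -
  have [simp]: "J \<in> Obj E" using assms hom_Obj by blast
  show ?thesis
    using assms by (simp add: bind_def hom_iff)
qed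

text \<open>Entry point to the calculus: a family parametrised by C and evaluated at
  \<open>x\<close> is reindexed along \<open>x\<close> to a family over the stage itself.\<close>

lemma bind_pair:
  assumes "x \<in> hom E J C" "P \<in> hom E J (TO T A)" "f \<in> hom E (C \<times>\<^sub>c A) (TO T B)"
    and "A \<in> Obj E" "B \<in> Obj E"
  shows "mu T B \<cdot> TA T f \<cdot> str T C A \<cdot> \<langle>x, P\<rangle> = bind A B (f \<cdot> \<langle>x \<cdot> pr1 E J A, pr2 E J A\<rangle>) P"
proof -
  have [simp]: "J \<in> Obj E" "C \<in> Obj E" using assms hom_Obj by blast+
  show ?thesis
    using assms str_pair_Id[of x P A] by (simp add: bind_def hom_iff TA_Comp_Comp)
qed

text \<open>Change of stage. It permits every later identity to be checked at an arbitrary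
  stage.\<close>

lemma bind_comp:
  assumes "P \<in> hom E J (TO T A)" "f \<in> hom E (J \<times>\<^sub>c A) (TO T B)" "u \<in> hom E K J"
    and "A \<in> Obj E" "B \<in> Obj E"
  shows "bind A B f P \<cdot> u = bind A B (f \<cdot> \<langle>u \<cdot> pr1 E K A, pr2 E K A\<rangle>) (P \<cdot> u)"
proof -
  have [simp]: "J \<in> Obj E" "K \<in> Obj E" using assms hom_Obj by blast+
  have "bind A B f P \<cdot> u = mu T B \<cdot> TA T f \<cdot> str T J A \<cdot> \<langle>u, P \<cdot> u\<rangle>"
    using assms by (simp add: bind_def hom_iff)
  also have "\<dots> = bind A B (f \<cdot> \<langle>u \<cdot> pr1 E K A, pr2 E K A\<rangle>) (P \<cdot> u)"
    by (rule bind_pair) (use assms in \<open>auto simp: hom_iff\<close>)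
  finally show ?thesis .
qed

text \<open>The left unit law of Kleisli extension; the strength axiom for the unit handles the
  parameter.\<close>

lemma bind_eta:
  assumes "a \<in> hom E J A" "f \<in> hom E (J \<times>\<^sub>c A) (TO T B)" "A \<in> Obj E" "B \<in> Obj E"
  shows "bind A B f (eta T A \<cdot> a) = f \<cdot> \<langle>Id E J, a\<rangle>"
proof -
  have [simp]: "J \<in> Obj E" using assms hom_Obj by blast
  have "str T J A \<cdot> \<langle>Id E J, eta T A \<cdot> a\<rangle> = (str T J A \<cdot> prod_map (Id E J) (eta T A)) \<cdot> \<langle>Id E J, a\<rangle>"
    using assms by (simp add: prod_map_def hom_iff)
  also have "\<dots> = eta T (J \<times>\<^sub>c A) \<cdot> \<langle>Id E J, a\<rangle>"
    using assms by (subst str_eta) simp_all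
  finally have "bind A B f (eta T A \<cdot> a) = mu T B \<cdot> (TA T f \<cdot> eta T (J \<times>\<^sub>c A)) \<cdot> \<langle>Id E J, a\<rangle>"
    using assms by (simp add: bind_def hom_iff)
  also have "\<dots> = (mu T B \<cdot> eta T (TO T B)) \<cdot> f \<cdot> \<langle>Id E J, a\<rangle>"
    using assms by (subst eta_nat[OF assms(2)]) (simp add: hom_iff)
  also have "\<dots> = f \<cdot> \<langle>Id E J, a\<rangle>"
    using assms by (subst mu_eta) (simp_all add: hom_iff)
  finally show ?thesis .
qed

text \<open>The unit axiom for the strength concerns only the terminal parameter object; naturality
  along \<open>bang J\<close> carries it to any J.\<close>

lemma TA_pr2_str:
  assumes "P \<in> hom E J (TO T A)" "A \<in> Obj E"
  shows "TA T (pr2 E J A) \<cdot> str T J A \<cdot> \<langle>Id E J, P\<rangle> = P"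
proof -
  have [simp]: "J \<in> Obj E" using assms hom_Obj by blast
  have "TA T (pr2 E J A) \<cdot> str T J A \<cdot> \<langle>Id E J, P\<rangle>
      = TA T (pr2 E \<one> A) \<cdot> TA T \<langle>bang J \<cdot> pr1 E J A, pr2 E J A\<rangle> \<cdot> str T J A \<cdot> \<langle>Id E J, P\<rangle>"
    using assms by (simp add: TA_Comp_Comp hom_iff)
  also have "\<dots> = TA T (pr2 E \<one> A) \<cdot> str T \<one> A \<cdot> \<langle>bang J, P\<rangle>"
    using assms str_pair_Id[of "bang J" P A] by (simp add: hom_iff)
  also have "\<dots> = (TA T (pr2 E \<one> A) \<cdot> str T \<one> A) \<cdot> \<langle>bang J, P\<rangle>"
    using assms by (simp add: hom_iff)
  also have "\<dots> = P"
    using assms by (subst str_unit) (simp_all add: hom_iff)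
  finally show ?thesis .
qed

lemma bind_TA:
  assumes "P \<in> hom E J (TO T A)" "g \<in> hom E A (TO T B)" "A \<in> Obj E" "B \<in> Obj E"
  shows "bind A B (g \<cdot> pr2 E J A) P = mu T B \<cdot> TA T g \<cdot> P"
proof -
  have [simp]: "J \<in> Obj E" using assms hom_Obj by blast
  show ?thesis
    using assms TA_pr2_str[OF assms(1,3)] by (simp add: bind_def hom_iff TA_Comp_Arr)
qed

lemma mu_T_eta_Comp: "\<lbrakk>P \<in> hom E J (TO T A); A \<in> Obj E\<rbrakk> \<Longrightarrow> mu T A \<cdot> TA T (eta T A) \<cdot> P = P"
  using mu_T_eta[of A] by (subst Comp_assoc_right[symmetric]) (auto simp: hom_iff)

lemma bind_eta_pr2:
  assumes "P \<in> hom E J (TO T A)" "g \<in> hom E A B" "A \<in> Obj E" "B \<in> Obj E"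
  shows "bind A B (eta T B \<cdot> g \<cdot> pr2 E J A) P = TA T g \<cdot> P"
proof -
  have [simp]: "J \<in> Obj E" using assms hom_Obj by blast
  show ?thesis
    using assms bind_TA[of P J A "eta T B \<cdot> g" B] mu_T_eta_Comp[of "TA T g \<cdot> P" J B]
    by (simp add: hom_iff TA_Comp_Arr)
qed

lemma bind_eta_right:
  assumes "P \<in> hom E J (TO T A)" "A \<in> Obj E"
  shows "bind A A (eta T A \<cdot> pr2 E J A) P = P"
proof -
  have [simp]: "J \<in> Obj E" using assms hom_Obj by blast
  show ?thesis
    using assms bind_TA[of P J A "eta T A" A] mu_T_eta_Comp[of P J A] by (simp add: hom_iff)
qed

text \<open>The associativity axiom of the strength, evaluated on the diagonal of J: using the same
  parameter twice amounts to duplicating it inside one use.\<close>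

lemma str_str_pair:
  assumes "P \<in> hom E J (TO T A)" "A \<in> Obj E"
  shows "str T J (J \<times>\<^sub>c A) \<cdot> \<langle>Id E J, str T J A \<cdot> \<langle>Id E J, P\<rangle>\<rangle>
    = TA T \<langle>pr1 E J A, Id E (J \<times>\<^sub>c A)\<rangle> \<cdot> str T J A \<cdot> \<langle>Id E J, P\<rangle>"
proof -
  have [simp]: "J \<in> Obj E" using assms hom_Obj by blast
  have "str T J (J \<times>\<^sub>c A) \<cdot> \<langle>Id E J, str T J A \<cdot> \<langle>Id E J, P\<rangle>\<rangle>
      = (str T J (J \<times>\<^sub>c A) \<cdot> prod_map (Id E J) (str T J A) \<cdot> assoc J J (TO T A))
          \<cdot> \<langle>\<langle>Id E J, Id E J\<rangle>, P\<rangle>"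
    using assms by (simp add: prod_map_def assoc_def hom_iff)
  also have "\<dots> = (TA T (assoc J J A) \<cdot> str T (J \<times>\<^sub>c J) A) \<cdot> \<langle>\<langle>Id E J, Id E J\<rangle>, P\<rangle>"
    using assms by (subst str_assoc) simp_all
  also have "\<dots> = TA T (assoc J J A) \<cdot> str T (J \<times>\<^sub>c J) A \<cdot> \<langle>\<langle>Id E J, Id E J\<rangle>, P\<rangle>"
    using assms by (simp add: assoc_def hom_iff)
  also have "\<dots> = TA T \<langle>pr1 E J A, Id E (J \<times>\<^sub>c A)\<rangle> \<cdot> str T J A \<cdot> \<langle>Id E J, P\<rangle>"
    using assms str_pair_Id[of "\<langle>Id E J, Id E J\<rangle>" P A] by (simp add: TA_Comp_Comp assoc_def hom_iff)
  finally show ?thesis .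
qed

text \<open>The associativity law of Kleisli extension. Both families depend on the parameter, so
  \<open>g\<close> is reindexed to the larger stage on which \<open>f\<close> lives, where it
  ignores the new variable.\<close>

lemma bind_bind:
  assumes "P \<in> hom E J (TO T A)" "f \<in> hom E (J \<times>\<^sub>c A) (TO T B)" "g \<in> hom E (J \<times>\<^sub>c B) (TO T C)"
    and "A \<in> Obj E" "B \<in> Obj E" "C \<in> Obj E"
  shows "bind B C g (bind A B f P)
    = bind A C (bind B C (g \<cdot> \<langle>pr1 E J A \<cdot> pr1 E (J \<times>\<^sub>c A) B, pr2 E (J \<times>\<^sub>c A) B\<rangle>) f) P"
proof -
  have [simp]: "J \<in> Obj E" using assms hom_Obj by blast
  define W where "W = str T J A \<cdot> \<langle>Id E J, P\<rangle>"
  have W: "W \<in> Arr E" "Dom E W = J" "Cod E W = TO T (J \<times>\<^sub>c A)"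
    using assms by (simp_all add: W_def hom_iff)
  note h = assms[unfolded hom_iff] W
  have "str T J B \<cdot> \<langle>Id E J, bind A B f P\<rangle>
      = (str T J B \<cdot> prod_map (Id E J) (mu T B)) \<cdot> \<langle>Id E J, TA T f \<cdot> W\<rangle>"
    using h by (simp add: prod_map_def bind_def W_def)
  also have "\<dots> = mu T (J \<times>\<^sub>c B) \<cdot> TA T (str T J B) \<cdot> str T J (TO T B) \<cdot> \<langle>Id E J, TA T f \<cdot> W\<rangle>"
    using h by (subst str_mu) simp_all
  also have "str T J (TO T B) \<cdot> \<langle>Id E J, TA T f \<cdot> W\<rangle>
      = TA T \<langle>pr1 E J (J \<times>\<^sub>c A), f \<cdot> pr2 E J (J \<times>\<^sub>c A)\<rangle> \<cdot> str T J (J \<times>\<^sub>c A) \<cdot> \<langle>Id E J, W\<rangle>"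
    using h str_pair[of "Id E J" W f] by simp
  also have "str T J (J \<times>\<^sub>c A) \<cdot> \<langle>Id E J, W\<rangle> = TA T \<langle>pr1 E J A, Id E (J \<times>\<^sub>c A)\<rangle> \<cdot> W"
    using str_str_pair[OF assms(1,4)] by (simp add: W_def)
  finally have 1: "bind B C g (bind A B f P)
      = mu T C \<cdot> TA T g \<cdot> mu T (J \<times>\<^sub>c B) \<cdot> TA T (str T J B \<cdot> \<langle>pr1 E J A, f\<rangle>) \<cdot> W"
    using h bind_hom[OF assms(1,2,4,5)]
    by (simp add: bind_def[of B C g] hom_iff TA_Comp_Comp)
  \<comment> \<open>Naturality of \<open>mu\<close> brings the two multiplications together, and
    associativity then moves one of them under T to form the inner extension.\<close>
  also have "\<dots> = mu T C \<cdot> mu T (TO T C) \<cdot> TA T (TA T g \<cdot> str T J B \<cdot> \<langle>pr1 E J A, f\<rangle>) \<cdot> W"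
    using h by (simp add: mu_nat_Comp TA_Comp_Arr)
  also have "\<dots> = mu T C \<cdot> TA T (mu T C) \<cdot> TA T (TA T g \<cdot> str T J B \<cdot> \<langle>pr1 E J A, f\<rangle>) \<cdot> W"
    using h mu_mu[of C] by (subst (1 2) Comp_assoc_right[symmetric]) simp_all
  also have "\<dots> = mu T C \<cdot> TA T (mu T C \<cdot> TA T g \<cdot> str T J B \<cdot> \<langle>pr1 E J A, f\<rangle>) \<cdot> W"
    using h by (simp add: TA_Comp_Comp)
  also have "mu T C \<cdot> TA T g \<cdot> str T J B \<cdot> \<langle>pr1 E J A, f\<rangle>
      = bind B C (g \<cdot> \<langle>pr1 E J A \<cdot> pr1 E (J \<times>\<^sub>c A) B, pr2 E (J \<times>\<^sub>c A) B\<rangle>) f"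
    by (rule bind_pair) (use h in \<open>auto simp: hom_iff\<close>)
  finally show ?thesis
    using h by (simp add: bind_def[of A C] W_def)
qed

lemma TA_bind:
  assumes "P \<in> hom E J (TO T A)" "f \<in> hom E (J \<times>\<^sub>c A) (TO T B)" "h \<in> hom E B C"
    and "A \<in> Obj E" "B \<in> Obj E" "C \<in> Obj E"
  shows "TA T h \<cdot> bind A B f P = bind A C (TA T h \<cdot> f) P"
proof -
  have [simp]: "J \<in> Obj E" using assms hom_Obj by blast
  show ?thesis
    using assms by (simp add: bind_def hom_iff mu_nat_Comp TA_Comp_Comp)
qed

lemma mu_TA_bind:
  assumes "P \<in> hom E J (TO T A)" "f \<in> hom E (J \<times>\<^sub>c A) (TO T B)" "h \<in> hom E B (TO T C)"
    and "A \<in> Obj E" "B \<in> Obj E" "C \<in> Obj E"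
  shows "mu T C \<cdot> TA T h \<cdot> bind A B f P = bind A C (mu T C \<cdot> TA T h \<cdot> f) P"
proof -
  have [simp]: "J \<in> Obj E" using assms hom_Obj by blast
  have "bind B C (h \<cdot> pr2 E J B) (bind A B f P)
      = bind A C (bind B C ((h \<cdot> pr2 E J B) \<cdot> \<langle>pr1 E J A \<cdot> pr1 E (J \<times>\<^sub>c A) B, pr2 E (J \<times>\<^sub>c A) B\<rangle>) f) P"
    by (rule bind_bind) (use assms in \<open>auto simp: hom_iff\<close>)
  then show ?thesis
    using assms bind_hom[OF assms(1,2,4,5)] bind_TA[OF bind_hom, OF assms(1,2,4,5,3,5,6)]
      bind_TA[OF assms(2,3,5,6)]
    by (simp add: hom_iff)
qed

text \<open>Change of variables: the push-forward along \<open>h\<close> is the extension of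
  \<open>eta T B \<cdot> h\<close>, so associativity followed by the unit law gives the
  substitution.\<close>

lemma bind_TA_right:
  assumes "P \<in> hom E J (TO T A)" "h \<in> hom E A B" "g \<in> hom E (J \<times>\<^sub>c B) (TO T C)"
    and "A \<in> Obj E" "B \<in> Obj E" "C \<in> Obj E"
  shows "bind B C g (TA T h \<cdot> P) = bind A C (g \<cdot> \<langle>pr1 E J A, h \<cdot> pr2 E J A\<rangle>) P"
proof -
  have [simp]: "J \<in> Obj E" using assms hom_Obj by blast
  show ?thesis
    using assms bind_bind[of P J A "eta T B \<cdot> h \<cdot> pr2 E J A" B g C]
      bind_eta[of "h \<cdot> pr2 E J A" "J \<times>\<^sub>c A" B
        "g \<cdot> \<langle>pr1 E J A \<cdot> pr1 E (J \<times>\<^sub>c A) B, pr2 E (J \<times>\<^sub>c A) B\<rangle>" C]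
    by (simp add: bind_eta_pr2 hom_iff)
qed

lemma bind_mu_TA:
  assumes "P \<in> hom E J (TO T A)" "h \<in> hom E A (TO T B)" "g \<in> hom E (J \<times>\<^sub>c B) (TO T C)"
    and "A \<in> Obj E" "B \<in> Obj E" "C \<in> Obj E"
  shows "bind B C g (mu T B \<cdot> TA T h \<cdot> P)
    = bind A C (bind B C (g \<cdot> \<langle>pr1 E J A \<cdot> pr1 E (J \<times>\<^sub>c A) B, pr2 E (J \<times>\<^sub>c A) B\<rangle>) (h \<cdot> pr2 E J A)) P"
proof -
  have [simp]: "J \<in> Obj E" using assms hom_Obj by blast
  show ?thesis
    using assms bind_bind[of P J A "h \<cdot> pr2 E J A" B g C] by (simp add: bind_TA hom_iff)
qed

lemma pairing_bind:
  assumes "P \<in> hom E I (TO T Y)" "\<phi> \<in> hom E I (Exp E Y (TO T X))" "X \<in> Obj E" "Y \<in> Obj E"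
  shows "pairing Y (TO T X) (mu T X) P \<phi> = bind Y X (uncurry Y (TO T X) \<phi>) P"
proof -
  have [simp]: "I \<in> Obj E" using assms hom_Obj by blast
  show ?thesis
    using assms bind_pair[of \<phi> I "Exp E Y (TO T X)" P Y "ev E Y (TO T X)" X]
    by (simp add: pairing_def T_fam_def uncurry_def prod_map_def hom_iff)
qed

text \<open>In \<open>tensor\<close> the first factor is the outer variable of integration, so the
  action of \<open>r\<close> integrates the constant \<open>P\<close> over \<open>r\<close>. The
  factor \<open>\<one>\<close> disappears by the unit axiom of the strength.\<close>

lemma smult_bind:
  assumes "r \<in> hom E J R" "P \<in> hom E J (TO T X)" "X \<in> Obj E"
  shows "smult X \<cdot> \<langle>r, P\<rangle> = bind \<one> X (P \<cdot> pr1 E J \<one>) r"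
proof -
  have [simp]: "J \<in> Obj E" using assms hom_Obj by blast
  have 1: "TA T (pr2 E \<one> X) \<cdot> str T \<one> X = pr2 E \<one> (TO T X)"
    using assms by (simp add: str_unit)
  have "smult X \<cdot> \<langle>r, P\<rangle> = mu T X \<cdot> TA T ((TA T (pr2 E \<one> X) \<cdot> str T \<one> X) \<cdot> swap (TO T X) \<one>)
      \<cdot> str T (TO T X) \<one> \<cdot> \<langle>P, r\<rangle>"
    using assms by (simp add: smult_def tensor_def str'_def swap_def hom_iff mu_nat_Comp TA_Comp_Comp)
  also have "\<dots> = bind \<one> X (P \<cdot> pr1 E J \<one>) r"
    unfolding 1 using assms bind_pair[of P J "TO T X" r \<one> "pr1 E (TO T X) \<one>" X]
    by (simp add: swap_def hom_iff)
  finally show ?thesis .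
qed

text \<open>With the scalar as outer variable this is an instance of associativity.\<close>

lemma bind_smult:
  assumes "r \<in> hom E J R" "P \<in> hom E J (TO T A)" "f \<in> hom E (J \<times>\<^sub>c A) (TO T B)"
    and "A \<in> Obj E" "B \<in> Obj E"
  shows "bind A B f (smult A \<cdot> \<langle>r, P\<rangle>) = smult B \<cdot> \<langle>r, bind A B f P\<rangle>"
proof -
  have [simp]: "J \<in> Obj E" using assms hom_Obj by blast
  have "bind A B f P \<cdot> pr1 E J \<one>
      = bind A B (f \<cdot> \<langle>pr1 E J \<one> \<cdot> pr1 E (J \<times>\<^sub>c \<one>) A, pr2 E (J \<times>\<^sub>c \<one>) A\<rangle>) (P \<cdot> pr1 E J \<one>)"
    by (rule bind_comp) (use assms in \<open>auto simp: hom_iff\<close>)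
  then show ?thesis
    using assms bind_bind[of r J \<one> "P \<cdot> pr1 E J \<one>" A f B] bind_hom[of P J A f B]
    by (simp add: smult_bind hom_iff)
qed

text \<open>Freeness of \<open>TO T A\<close> on \<open>eta T A\<close>: a homomorphism is recovered
  from its restriction to the generators.\<close>

lemma T_linear_unique:
  assumes "T_linear (TO T A) (mu T A) B b h" "T_linear (TO T A) (mu T A) B b k"
    and "A \<in> Obj E" "b \<in> hom E (TO T B) B" "h \<cdot> eta T A = k \<cdot> eta T A"
  shows "h = k"
proof -
  have *: "l = b \<cdot> TA T (l \<cdot> eta T A)" if "T_linear (TO T A) (mu T A) B b l" for l
  proof -
    have l: "l \<in> Arr E" "Dom E l = TO T A" "Cod E l = B" "l \<cdot> mu T A = b \<cdot> TA T l"
      using that by (auto simp: T_linear_def hom_iff)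
    have "l = (l \<cdot> mu T A) \<cdot> TA T (eta T A)"
      using l(1-3) assms(3) by (simp add: mu_T_eta)
    also have "\<dots> = b \<cdot> TA T (l \<cdot> eta T A)"
      unfolding l(4) using l(1-3) assms(3,4) by (simp add: TA_Comp_Arr hom_iff)
    finally show ?thesis .
  qed
  show ?thesis
    using *[OF assms(1)] *[OF assms(2)] assms(5) by simp
qed

text \<open>The extension of \<open>k\<close> is a homomorphism out of the free algebra;
  \<open>mu_TA_eta\<close> supplies its restriction to generators. Both serve to identify
  \<open>Phi\<close>.\<close>

lemma mu_TA_mu:
  assumes "k \<in> hom E A (TO T X)" "X \<in> Obj E"
  shows "mu T X \<cdot> TA T k \<cdot> mu T A = mu T X \<cdot> TA T (mu T X \<cdot> TA T k)"
proof -
  have [simp]: "A \<in> Obj E" using assms hom_Obj by blast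
  have "mu T X \<cdot> TA T k \<cdot> mu T A = (mu T X \<cdot> mu T (TO T X)) \<cdot> TA T (TA T k)"
    using assms mu_nat[OF assms(1)] by (simp add: hom_iff)
  also have "\<dots> = mu T X \<cdot> TA T (mu T X \<cdot> TA T k)"
    using assms by (subst mu_mu) (simp_all add: hom_iff TA_Comp_Arr)
  finally show ?thesis .
qed

lemma mu_TA_eta:
  assumes "k \<in> hom E A (TO T X)" "X \<in> Obj E"
  shows "mu T X \<cdot> TA T k \<cdot> eta T A = k"
proof -
  have [simp]: "A \<in> Obj E" using assms hom_Obj by blast
  have "mu T X \<cdot> TA T k \<cdot> eta T A = (mu T X \<cdot> eta T (TO T X)) \<cdot> k"
    using assms eta_nat[OF assms(1)] by (simp add: hom_iff)
  then show ?thesis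
    using assms mu_eta[OF assms(2)] by (simp add: hom_iff)
qed

lemma is_derivative_hom: "is_derivative D \<iota> V pl sm I f f' \<Longrightarrow> f' \<in> hom E (I \<times>\<^sub>c R) V"
  by (simp add: is_derivative_def)

end

section \<open>Scalars and the order of integration\<close>

context commutative_monad
begin

text \<open>The opposite reading of the action: multiplication by \<open>r\<close> is the Kleisli
  extension of \<open>x \<mapsto> r \<cdot> \<eta>(x)\<close>, now with \<open>P\<close> as the
  outer variable.\<close>

lemma smult_bind_right:
  assumes "r \<in> hom E J R" "P \<in> hom E J (TO T X)" "X \<in> Obj E"
  shows "smult X \<cdot> \<langle>r, P\<rangle> = bind X X (smult X \<cdot> \<langle>r \<cdot> pr1 E J X, eta T X \<cdot> pr2 E J X\<rangle>) P"
proof -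
  have [simp]: "J \<in> Obj E" using assms hom_Obj by blast
  define w where "w = TA T (pr1 E X \<one>) \<cdot> str T X \<one> \<cdot> swap R X"
  have 1: "TA T (pr2 E \<one> X) \<cdot> str' \<one> X = w"
    using assms by (simp add: str'_def w_def swap_def hom_iff TA_Comp_Comp)
  have w: "w \<in> Arr E" "Dom E w = R \<times>\<^sub>c X" "Cod E w = TO T X"
    using assms by (simp_all add: w_def swap_def)
  have s: "str' \<one> X \<in> Arr E" "Dom E (str' \<one> X) = R \<times>\<^sub>c X" "Cod E (str' \<one> X) = TO T (\<one> \<times>\<^sub>c X)"
    using assms by (simp_all add: str'_def swap_def)
  \<comment> \<open>Commutativity of the monad exchanges the two integrations hidden in
    \<open>tensor\<close>.\<close>
  have "smult X \<cdot> \<langle>r, P\<rangle> = TA T (pr2 E \<one> X) \<cdot> (mu T (\<one> \<times>\<^sub>c X) \<cdot> TA T (str' \<one> X) \<cdot> str T R X) \<cdot> \<langle>r, P\<rangle>"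
    using assms commutative[of \<one> X] s by (simp add: smult_def tensor_def hom_iff)
  also have "\<dots> = mu T X \<cdot> TA T (TA T (pr2 E \<one> X) \<cdot> str' \<one> X) \<cdot> str T R X \<cdot> \<langle>r, P\<rangle>"
    using assms s by (simp add: hom_iff mu_nat_Comp TA_Comp_Comp)
  also have "\<dots> = bind X X (w \<cdot> \<langle>r \<cdot> pr1 E J X, pr2 E J X\<rangle>) P"
    unfolding 1 using assms w by (intro bind_pair) (auto simp: hom_iff)
  also have "w \<cdot> \<langle>r \<cdot> pr1 E J X, pr2 E J X\<rangle>
      = TA T (pr1 E X \<one>) \<cdot> str T X \<one> \<cdot> \<langle>pr2 E J X, r \<cdot> pr1 E J X\<rangle>"
    using assms by (simp add: w_def swap_def hom_iff)
  also have "\<dots> = TA T (pr2 E J X \<cdot> pr1 E (J \<times>\<^sub>c X) \<one>) \<cdot> str T (J \<times>\<^sub>c X) \<one>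
      \<cdot> \<langle>Id E (J \<times>\<^sub>c X), r \<cdot> pr1 E J X\<rangle>"
    using assms str_pair_Id[of "pr2 E J X" "r \<cdot> pr1 E J X" \<one>] by (simp add: hom_iff TA_Comp_Comp)
  also have "\<dots> = bind \<one> X (eta T X \<cdot> pr2 E J X \<cdot> pr1 E (J \<times>\<^sub>c X) \<one>) (r \<cdot> pr1 E J X)"
    using assms by (simp add: bind_def hom_iff TA_Comp_Arr mu_T_eta_Comp[where J = "J \<times>\<^sub>c X"])
  also have "\<dots> = smult X \<cdot> \<langle>r \<cdot> pr1 E J X, eta T X \<cdot> pr2 E J X\<rangle>"
    using assms by (subst smult_bind) (auto simp: hom_iff)
  finally show ?thesis .
qed

lemma smult_simps [simp]:
  assumes "X \<in> Obj E"
  shows "smult X \<in> Arr E" "Dom E (smult X) = R \<times>\<^sub>c TO T X" "Cod E (smult X) = TO T X"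
  using assms by (simp_all add: smult_def tensor_def str'_def swap_def)

text \<open>A scalar in the integrand may be taken outside: after \<open>smult_bind_right\<close>
  both sides are iterated extensions, equal by associativity.\<close>

lemma smult_bind_commute:
  assumes "r \<in> hom E J R" "P \<in> hom E J (TO T A)" "f \<in> hom E (J \<times>\<^sub>c A) (TO T X)"
    and "A \<in> Obj E" "X \<in> Obj E"
  shows "bind A X (smult X \<cdot> \<langle>r \<cdot> pr1 E J A, f\<rangle>) P = smult X \<cdot> \<langle>r, bind A X f P\<rangle>"
proof -
  have [simp]: "J \<in> Obj E" using assms hom_Obj by blast
  show ?thesis
    using assms bind_hom[of P J A f X]
      smult_bind_right[of r J "bind A X f P" X] smult_bind_right[of "r \<cdot> pr1 E J A" "J \<times>\<^sub>c A" f X]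
      bind_bind[of P J A f X "smult X \<cdot> \<langle>r \<cdot> pr1 E J X, eta T X \<cdot> pr2 E J X\<rangle>" X]
    by (simp add: hom_iff)
qed

end

section \<open>Addition, zero and negation, and linearity of Kleisli extension\<close>

context additive_monad
begin

text \<open>All zeros are push-forwards of one point of T(Initial), so facts about zero reduce to
  facts about families on the initial object.\<close>

lemma T_Initial_pt:
  "\<exists>z\<in>hom E \<one> (TO T (Initial E)). \<forall>Y. zero_pt Y = TA T (cobang Y) \<cdot> z"
proof
  have "\<exists>!h. h \<in> hom E \<one> (TO T (Initial E))"
    using T_Initial by (simp add: terminal_obj_def)
  then show "(THE h. h \<in> hom E \<one> (TO T (Initial E))) \<in> hom E \<one> (TO T (Initial E))"
    by (rule theI')
qed (simp add: zero_pt_def)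

lemma zero_pt_simps [simp]:
  assumes "Y \<in> Obj E"
  shows "zero_pt Y \<in> Arr E" "Dom E (zero_pt Y) = \<one>" "Cod E (zero_pt Y) = TO T Y"
  using assms T_Initial_pt by (auto simp: hom_iff)

lemma zero_hom: "\<lbrakk>J \<in> Obj E; Y \<in> Obj E\<rbrakk> \<Longrightarrow> zero_pt Y \<cdot> bang J \<in> hom E J (TO T Y)"
  by (simp add: hom_iff)

text \<open>Any two families on a product with the initial object coincide, so the integrand can be
  replaced by one whose extension is visibly zero.\<close>

lemma bind_zero:
  assumes "f \<in> hom E (J \<times>\<^sub>c A) (TO T B)" "J \<in> Obj E" "A \<in> Obj E" "B \<in> Obj E"
  shows "bind A B f (zero_pt A \<cdot> bang J) = zero_pt B \<cdot> bang J"
proof -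
  obtain z where z: "z \<in> hom E \<one> (TO T (Initial E))" "\<And>Y. zero_pt Y = TA T (cobang Y) \<cdot> z"
    using T_Initial_pt by blast
  have zJ: "z \<cdot> bang J \<in> hom E J (TO T (Initial E))"
    using z assms by (auto simp: hom_iff)
  have "bind A B f (zero_pt A \<cdot> bang J) = bind A B f (TA T (cobang A) \<cdot> z \<cdot> bang J)"
    using z assms by (simp add: hom_iff)
  also have "\<dots> = bind (Initial E) B (f \<cdot> \<langle>pr1 E J (Initial E), cobang A \<cdot> pr2 E J (Initial E)\<rangle>) (z \<cdot> bang J)"
    by (rule bind_TA_right) (use zJ assms in \<open>auto simp: hom_iff\<close>)
  also have "f \<cdot> \<langle>pr1 E J (Initial E), cobang A \<cdot> pr2 E J (Initial E)\<rangle>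
      = eta T B \<cdot> cobang B \<cdot> pr2 E J (Initial E)"
    by (rule Prod_Initial_unique) (use assms in \<open>auto simp: hom_iff\<close>)
  also have "bind (Initial E) B (eta T B \<cdot> cobang B \<cdot> pr2 E J (Initial E)) (z \<cdot> bang J)
      = TA T (cobang B) \<cdot> z \<cdot> bang J"
    by (rule bind_eta_pr2) (use zJ assms in \<open>auto simp: hom_iff\<close>)
  also have "\<dots> = zero_pt B \<cdot> bang J"
    using z assms by (simp add: hom_iff)
  finally show ?thesis .
qed

definition proj1 :: "'o \<Rightarrow> 'm" where
  "proj1 X = copair X X (eta T X) (zero_arr X X)"

definition proj2 :: "'o \<Rightarrow> 'm" where
  "proj2 X = copair X X (zero_arr X X) (eta T X)"

lemma proj_props:
  assumes "X \<in> Obj E"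
  shows "proj1 X \<in> hom E (X +\<^sub>c X) (TO T X)" "proj2 X \<in> hom E (X +\<^sub>c X) (TO T X)"
    "proj1 X \<cdot> in1 E X X = eta T X" "proj1 X \<cdot> in2 E X X = zero_arr X X"
    "proj2 X \<cdot> in1 E X X = zero_arr X X" "proj2 X \<cdot> in2 E X X = eta T X"
  using assms copair_props[of "eta T X" X "TO T X" "zero_arr X X" X]
    copair_props[of "zero_arr X X" X "TO T X" "eta T X" X]
  by (simp_all add: proj1_def proj2_def zero_arr_def hom_iff)

lemma proj_simps [simp]:
  assumes "X \<in> Obj E"
  shows "proj1 X \<in> Arr E" "Dom E (proj1 X) = X +\<^sub>c X" "Cod E (proj1 X) = TO T X"
    "proj2 X \<in> Arr E" "Dom E (proj2 X) = X +\<^sub>c X" "Cod E (proj2 X) = TO T X"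
  using proj_props[OF assms] by (auto simp: hom_iff)

text \<open>The components of \<open>Phi\<close> are the Kleisli extensions of \<open>proj1\<close>
  and \<open>proj2\<close>. This explicit form replaces the description, and only the diagonal case
  enters the addition.\<close>

lemma Phi_eq:
  assumes "X \<in> Obj E"
  shows "Phi X X = \<langle>mu T X \<cdot> TA T (proj1 X), mu T X \<cdot> TA T (proj2 X)\<rangle>" (is "_ = ?F")
  unfolding Phi_def
proof (rule the_equality, intro conjI)
  let ?B = "TO T X \<times>\<^sub>c TO T X" and ?b = "prod_alg (TO T X) (mu T X) (TO T X) (mu T X)"
  have b: "?b \<in> hom E (TO T ?B) ?B"
    using assms by (simp add: prod_alg_def hom_iff)
  have eta: "?F \<cdot> eta T (X +\<^sub>c X) = \<langle>proj1 X, proj2 X\<rangle>"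
    using assms by (simp add: mu_TA_eta[OF proj_props(1)] mu_TA_eta[OF proj_props(2)])
  then have "(?F \<cdot> eta T (X +\<^sub>c X)) \<cdot> in1 E X X = \<langle>eta T X, zero_arr X X\<rangle>"
    "(?F \<cdot> eta T (X +\<^sub>c X)) \<cdot> in2 E X X = \<langle>zero_arr X X, eta T X\<rangle>"
    using assms proj_props[OF assms] by simp_all
  then show F1: "?F \<cdot> eta T (X +\<^sub>c X) \<cdot> in1 E X X = \<langle>eta T X, zero_arr X X\<rangle>"
    and F2: "?F \<cdot> eta T (X +\<^sub>c X) \<cdot> in2 E X X = \<langle>zero_arr X X, eta T X\<rangle>"
    using assms by simp_all
  show F: "T_linear (TO T (X +\<^sub>c X)) (mu T (X +\<^sub>c X)) ?B ?b ?F"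
    using assms mu_TA_mu[OF proj_props(1)[OF assms] assms] mu_TA_mu[OF proj_props(2)[OF assms] assms]
    by (simp add: T_linear_def prod_alg_def hom_iff TA_Comp_Arr[symmetric])
  show "h = ?F" if h: "T_linear (TO T (X +\<^sub>c X)) (mu T (X +\<^sub>c X)) ?B ?b h \<and>
      h \<cdot> eta T (X +\<^sub>c X) \<cdot> in1 E X X = \<langle>eta T X, zero_arr X X\<rangle> \<and>
      h \<cdot> eta T (X +\<^sub>c X) \<cdot> in2 E X X = \<langle>zero_arr X X, eta T X\<rangle>" for h
  proof (rule T_linear_unique[OF _ F _ b])
    have ha: "h \<in> Arr E" "Dom E h = TO T (X +\<^sub>c X)" "Cod E h = ?B"
      using h by (auto simp: T_linear_def hom_iff)
    show "h \<cdot> eta T (X +\<^sub>c X) = ?F \<cdot> eta T (X +\<^sub>c X)"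
    proof (rule Coprod_eqI[where C = ?B])
      show "(h \<cdot> eta T (X +\<^sub>c X)) \<cdot> in1 E X X = (?F \<cdot> eta T (X +\<^sub>c X)) \<cdot> in1 E X X"
        using h ha F1 assms by (subst (1 2) Comp_assoc_right) simp_all
      show "(h \<cdot> eta T (X +\<^sub>c X)) \<cdot> in2 E X X = (?F \<cdot> eta T (X +\<^sub>c X)) \<cdot> in2 E X X"
        using h ha F2 assms by (subst (1 2) Comp_assoc_right) simp_all
    qed (use ha assms in \<open>simp_all add: hom_iff\<close>)
  qed (use h assms in simp_all)
qed

lemma Phi_inverse:
  assumes "X \<in> Obj E"
  shows "inv_arr (Phi X X) \<in> hom E (TO T X \<times>\<^sub>c TO T X) (TO T (X +\<^sub>c X))"
    "inv_arr (Phi X X) \<cdot> Phi X X = Id E (TO T (X +\<^sub>c X))"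
    "Phi X X \<cdot> inv_arr (Phi X X) = Id E (TO T X \<times>\<^sub>c TO T X)"
  using inverse_arr_inv_arr[OF Phi_iso[OF assms assms]] assms
  by (simp_all add: inverse_arr_def Phi_eq)

lemma add_simps [simp]:
  assumes "X \<in> Obj E"
  shows "add X \<in> Arr E" "Dom E (add X) = TO T X \<times>\<^sub>c TO T X" "Cod E (add X) = TO T X"
  using assms Phi_inverse(1)[OF assms] by (simp_all add: add_def hom_iff)

lemma add_pair_hom:
  "\<lbrakk>a \<in> hom E J (TO T X); b \<in> hom E J (TO T X); X \<in> Obj E\<rbrakk> \<Longrightarrow> add X \<cdot> \<langle>a, b\<rangle> \<in> hom E J (TO T X)"
  by (simp add: hom_iff)

text \<open>Eliminates the inverse of \<open>Phi\<close>: addition is characterised on pairs already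
  presented as the image of some \<open>W\<close>, and \<open>proj_surj\<close> provides such a
  \<open>W\<close> for every pair.\<close>

lemma add_proj:
  assumes "W \<in> hom E J (TO T (X +\<^sub>c X))" "X \<in> Obj E"
  shows "add X \<cdot> \<langle>mu T X \<cdot> TA T (proj1 X) \<cdot> W, mu T X \<cdot> TA T (proj2 X) \<cdot> W\<rangle> = TA T (codiagonal X) \<cdot> W"
proof -
  have i: "inv_arr (Phi X X) \<in> Arr E" "Dom E (inv_arr (Phi X X)) = TO T X \<times>\<^sub>c TO T X"
    "Cod E (inv_arr (Phi X X)) = TO T (X +\<^sub>c X)"
    using Phi_inverse(1)[OF assms(2)] by (auto simp: hom_iff)
  have p: "Phi X X \<in> Arr E" "Dom E (Phi X X) = TO T (X +\<^sub>c X)" "Cod E (Phi X X) = TO T X \<times>\<^sub>c TO T X"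
    using assms by (simp_all add: Phi_eq)
  have "\<langle>mu T X \<cdot> TA T (proj1 X) \<cdot> W, mu T X \<cdot> TA T (proj2 X) \<cdot> W\<rangle> = Phi X X \<cdot> W"
    using assms by (simp add: Phi_eq hom_iff)
  then have "add X \<cdot> \<langle>mu T X \<cdot> TA T (proj1 X) \<cdot> W, mu T X \<cdot> TA T (proj2 X) \<cdot> W\<rangle>
      = TA T (codiagonal X) \<cdot> (inv_arr (Phi X X) \<cdot> Phi X X) \<cdot> W"
    using assms i p by (simp add: add_def hom_iff)
  then show ?thesis
    using assms by (simp add: Phi_inverse hom_iff)
qed

lemma proj_surj:
  assumes "f \<in> hom E J (TO T X)" "g \<in> hom E J (TO T X)" "X \<in> Obj E"
  obtains W where "W \<in> hom E J (TO T (X +\<^sub>c X))"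
    "f = mu T X \<cdot> TA T (proj1 X) \<cdot> W" "g = mu T X \<cdot> TA T (proj2 X) \<cdot> W"
proof -
  let ?W = "inv_arr (Phi X X) \<cdot> \<langle>f, g\<rangle>"
  have i: "inv_arr (Phi X X) \<in> Arr E" "Dom E (inv_arr (Phi X X)) = TO T X \<times>\<^sub>c TO T X"
    "Cod E (inv_arr (Phi X X)) = TO T (X +\<^sub>c X)"
    using Phi_inverse(1)[OF assms(3)] by (auto simp: hom_iff)
  have p: "Phi X X \<in> Arr E" "Dom E (Phi X X) = TO T (X +\<^sub>c X)" "Cod E (Phi X X) = TO T X \<times>\<^sub>c TO T X"
    using assms by (simp_all add: Phi_eq)
  have W: "?W \<in> hom E J (TO T (X +\<^sub>c X))"
    using assms i by (simp add: hom_iff)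
  have "Phi X X \<cdot> ?W = (Phi X X \<cdot> inv_arr (Phi X X)) \<cdot> \<langle>f, g\<rangle>"
    using assms i p by (simp add: hom_iff)
  then have "Phi X X \<cdot> ?W = \<langle>f, g\<rangle>"
    using assms by (simp add: Phi_inverse hom_iff)
  then obtain W where W: "W \<in> hom E J (TO T (X +\<^sub>c X))" and eq: "Phi X X \<cdot> W = \<langle>f, g\<rangle>"
    using W by blast
  have "pr1 E (TO T X) (TO T X) \<cdot> Phi X X \<cdot> W = f" "pr2 E (TO T X) (TO T X) \<cdot> Phi X X \<cdot> W = g"
    unfolding eq using assms by (simp_all add: hom_iff)
  then show thesis
    using assms W by (intro that[of W]) (simp_all add: Phi_eq hom_iff)
qed

text \<open>One \<open>W\<close> at the stage of the integrands represents the pair; the codiagonal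
  and both projections are homomorphisms, hence commute with integrating \<open>W\<close> over
  \<open>P\<close>.\<close>

lemma bind_add_left:
  assumes "P \<in> hom E J (TO T A)" "f \<in> hom E (J \<times>\<^sub>c A) (TO T X)" "g \<in> hom E (J \<times>\<^sub>c A) (TO T X)"
    and "A \<in> Obj E" "X \<in> Obj E"
  shows "bind A X (add X \<cdot> \<langle>f, g\<rangle>) P = add X \<cdot> \<langle>bind A X f P, bind A X g P\<rangle>"
proof -
  have [simp]: "J \<in> Obj E" using assms hom_Obj by blast
  obtain W where W: "W \<in> hom E (J \<times>\<^sub>c A) (TO T (X +\<^sub>c X))"
    and f: "f = mu T X \<cdot> TA T (proj1 X) \<cdot> W" and g: "g = mu T X \<cdot> TA T (proj2 X) \<cdot> W"
    using proj_surj[OF assms(2,3,5)] .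
  have V: "bind A (X +\<^sub>c X) W P \<in> hom E J (TO T (X +\<^sub>c X))"
    using assms W by (intro bind_hom) auto
  have "bind A X (add X \<cdot> \<langle>f, g\<rangle>) P = bind A X (TA T (codiagonal X) \<cdot> W) P"
    unfolding f g using assms W by (simp add: add_proj)
  also have "\<dots> = TA T (codiagonal X) \<cdot> bind A (X +\<^sub>c X) W P"
    by (rule TA_bind[symmetric]) (use assms W codiagonal_props in auto)
  also have "\<dots> = add X \<cdot> \<langle>mu T X \<cdot> TA T (proj1 X) \<cdot> bind A (X +\<^sub>c X) W P,
      mu T X \<cdot> TA T (proj2 X) \<cdot> bind A (X +\<^sub>c X) W P\<rangle>"
    by (rule add_proj[symmetric]) (use assms V in auto)
  also have "\<dots> = add X \<cdot> \<langle>bind A X f P, bind A X g P\<rangle>"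
    unfolding f g using assms W proj_props[of X] by (simp add: mu_TA_bind)
  finally show ?thesis .
qed

lemma add_assoc:
  "\<lbrakk>a \<in> hom E J (TO T X); b \<in> hom E J (TO T X); c \<in> hom E J (TO T X); X \<in> Obj E\<rbrakk>
    \<Longrightarrow> add X \<cdot> \<langle>add X \<cdot> \<langle>a, b\<rangle>, c\<rangle> = add X \<cdot> \<langle>a, add X \<cdot> \<langle>b, c\<rangle>\<rangle>"
  using abelian_group[of X] hom_Obj(1)[of a J "TO T X"] unfolding abelian_group_object_def by blast

lemma add_commute:
  "\<lbrakk>a \<in> hom E J (TO T X); b \<in> hom E J (TO T X); X \<in> Obj E\<rbrakk>
    \<Longrightarrow> add X \<cdot> \<langle>a, b\<rangle> = add X \<cdot> \<langle>b, a\<rangle>"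
  using abelian_group[of X] hom_Obj(1)[of a J "TO T X"] unfolding abelian_group_object_def by blast

lemma add_zero: "\<lbrakk>a \<in> hom E J (TO T X); X \<in> Obj E\<rbrakk> \<Longrightarrow> add X \<cdot> \<langle>a, zero_pt X \<cdot> bang J\<rangle> = a"
  using abelian_group[of X] hom_Obj(1)[of a J "TO T X"] unfolding abelian_group_object_def by blast

lemma zero_add: "\<lbrakk>a \<in> hom E J (TO T X); X \<in> Obj E\<rbrakk> \<Longrightarrow> add X \<cdot> \<langle>zero_pt X \<cdot> bang J, a\<rangle> = a"
  using add_zero[of a J X] add_commute[of a J X "zero_pt X \<cdot> bang J"] zero_hom[of J X]
    hom_Obj(1)[of a J "TO T X"] by simp

lemma ex_neg:
  assumes "X \<in> Obj E"
  obtains n where "n \<in> hom E (TO T X) (TO T X)"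
    "\<And>J a. a \<in> hom E J (TO T X) \<Longrightarrow> add X \<cdot> \<langle>a, n \<cdot> a\<rangle> = zero_pt X \<cdot> bang J"
proof -
  obtain n where n: "n \<in> hom E (TO T X) (TO T X)"
    "\<forall>J\<in>Obj E. \<forall>a\<in>hom E J (TO T X). add X \<cdot> \<langle>a, n \<cdot> a\<rangle> = zero_pt X \<cdot> bang J"
    using abelian_group[OF assms] unfolding abelian_group_object_def by blast
  show thesis
    by (rule that[OF n(1)]) (use n(2) hom_Obj in blast)
qed

lemma add_left_cancel:
  assumes "add X \<cdot> \<langle>a, b\<rangle> = add X \<cdot> \<langle>a, c\<rangle>"
    and h: "a \<in> hom E J (TO T X)" "b \<in> hom E J (TO T X)" "c \<in> hom E J (TO T X)" "X \<in> Obj E"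
  shows "b = c"
proof -
  obtain n where n: "n \<in> hom E (TO T X) (TO T X)"
    "\<And>J a. a \<in> hom E J (TO T X) \<Longrightarrow> add X \<cdot> \<langle>a, n \<cdot> a\<rangle> = zero_pt X \<cdot> bang J"
    using ex_neg[OF h(4)] by blast
  have na: "n \<cdot> a \<in> hom E J (TO T X)"
    using Comp_hom[OF h(1) n(1)] .
  have *: "add X \<cdot> \<langle>n \<cdot> a, add X \<cdot> \<langle>a, x\<rangle>\<rangle> = x" if x: "x \<in> hom E J (TO T X)" for x
    unfolding add_assoc[OF na h(1) x h(4), symmetric] add_commute[OF na h(1,4)] n(2)[OF h(1)]
    by (rule zero_add[OF x h(4)])
  show ?thesis
    using *[OF h(2)] *[OF h(3)] assms(1) by metis
qed

lemma neg_props: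
  assumes "X \<in> Obj E"
  shows "neg X \<in> hom E (TO T X) (TO T X)"
    "\<And>J a. a \<in> hom E J (TO T X) \<Longrightarrow> add X \<cdot> \<langle>a, neg X \<cdot> a\<rangle> = zero_pt X \<cdot> bang J"
proof -
  let ?Q = "\<lambda>n. n \<in> hom E (TO T X) (TO T X) \<and>
    (\<forall>J\<in>Obj E. \<forall>a\<in>hom E J (TO T X). add X \<cdot> \<langle>a, n \<cdot> a\<rangle> = zero_pt X \<cdot> bang J)"
  obtain n where n: "?Q n"
    using ex_neg[OF assms] by metis
  have "m = n" if m: "?Q m" for m
  proof (rule add_left_cancel)
    \<comment> \<open>An arrow out of \<open>TO T X\<close> is determined by its value at the
      generic element, so two candidate negations need only be compared there.\<close>
    let ?i = "Id E (TO T X)"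
    have "add X \<cdot> \<langle>?i, l \<cdot> ?i\<rangle> = zero_pt X \<cdot> bang (TO T X)" if "?Q l" for l
      using that TO_Obj[OF assms] Id_hom[of "TO T X"] by blast
    then have "add X \<cdot> \<langle>?i, m \<cdot> ?i\<rangle> = add X \<cdot> \<langle>?i, n \<cdot> ?i\<rangle>"
      using m n by metis
    then show "add X \<cdot> \<langle>?i, m\<rangle> = add X \<cdot> \<langle>?i, n\<rangle>"
      using m n Comp_Id by metis
  qed (use m n assms Id_hom in auto)
  then have "?Q (neg X)"
    unfolding neg_def using n by (intro theI[of ?Q n]) blast+
  then show "neg X \<in> hom E (TO T X) (TO T X)"
    "\<And>J a. a \<in> hom E J (TO T X) \<Longrightarrow> add X \<cdot> \<langle>a, neg X \<cdot> a\<rangle> = zero_pt X \<cdot> bang J"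
    using hom_Obj by blast+
qed

lemma neg_comp_hom: "\<lbrakk>a \<in> hom E J (TO T X); X \<in> Obj E\<rbrakk> \<Longrightarrow> neg X \<cdot> a \<in> hom E J (TO T X)"
  using Comp_hom neg_props(1) by blast

lemma add_eq_iff:
  assumes "a \<in> hom E J (TO T X)" "b \<in> hom E J (TO T X)" "c \<in> hom E J (TO T X)" "X \<in> Obj E"
  shows "add X \<cdot> \<langle>a, b\<rangle> = c \<longleftrightarrow> a = add X \<cdot> \<langle>c, neg X \<cdot> b\<rangle>"
proof -
  note nb = neg_comp_hom[OF assms(2,4)]
  note s = add_pair_hom[OF assms(3) nb assms(4)]
  have 1: "add X \<cdot> \<langle>b, add X \<cdot> \<langle>c, neg X \<cdot> b\<rangle>\<rangle> = c"
    unfolding add_commute[OF assms(2) s assms(4)] add_assoc[OF assms(3) nb assms(2,4)]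
      add_commute[OF nb assms(2,4)] neg_props(2)[OF assms(4,2)]
    by (rule add_zero[OF assms(3,4)])
  show ?thesis
    using 1 add_left_cancel[of X b a "add X \<cdot> \<langle>c, neg X \<cdot> b\<rangle>" J] assms s
      add_commute[OF assms(1,2,4)] add_commute[OF assms(2) s assms(4)] by metis
qed

lemma add_eq_zero_iff:
  assumes "a \<in> hom E J (TO T X)" "b \<in> hom E J (TO T X)" "X \<in> Obj E"
  shows "add X \<cdot> \<langle>a, b\<rangle> = zero_pt X \<cdot> bang J \<longleftrightarrow> a = neg X \<cdot> b"
  using add_eq_iff[OF assms(1,2) zero_hom assms(3)] zero_add[OF neg_comp_hom[OF assms(2,3)] assms(3)]
    hom_Obj[OF assms(1)] assms(3) by simp

text \<open>Put \<open>(P, Q) = \<Phi>(W)\<close>.  As functions of \<open>W\<close>, both sides are Kleisli extensions of families on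
  \<open>J \<times>\<^sub>c (A +\<^sub>c A)\<close>, and these agree on the two summands by the unit laws of addition.\<close>

lemma bind_add_right:
  assumes P: "P \<in> hom E J (TO T A)" and Q: "Q \<in> hom E J (TO T A)"
    and f: "f \<in> hom E (J \<times>\<^sub>c A) (TO T B)" and o: "A \<in> Obj E" "B \<in> Obj E"
  shows "bind A B f (add A \<cdot> \<langle>P, Q\<rangle>) = add B \<cdot> \<langle>bind A B f P, bind A B f Q\<rangle>"
proof -
  note [simp] = o
  have [simp]: "J \<in> Obj E" using P hom_Obj by blast
  obtain W where W: "W \<in> hom E J (TO T (A +\<^sub>c A))"
    and P_eq: "P = mu T A \<cdot> TA T (proj1 A) \<cdot> W" and Q_eq: "Q = mu T A \<cdot> TA T (proj2 A) \<cdot> W"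
    using proj_surj[OF P Q o(1)] .
  let ?S = "A +\<^sub>c A"
  \<comment> \<open>\<open>f'\<close> is \<open>f\<close> with the summand variable as a dummy
    parameter. \<open>G1\<close> and \<open>G2\<close> are the integrands that produce the two
    components from the single \<open>W\<close>; \<open>f''\<close> is what \<open>f'\<close>
    becomes after restriction to one summand.\<close>
  define f' where "f' = f \<cdot> \<langle>pr1 E J ?S \<cdot> pr1 E (J \<times>\<^sub>c ?S) A, pr2 E (J \<times>\<^sub>c ?S) A\<rangle>"
  define G1 where "G1 = bind A B f' (proj1 A \<cdot> pr2 E J ?S)"
  define G2 where "G2 = bind A B f' (proj2 A \<cdot> pr2 E J ?S)"
  define f'' where "f'' = f \<cdot> \<langle>pr1 E J A \<cdot> pr1 E (J \<times>\<^sub>c A) A, pr2 E (J \<times>\<^sub>c A) A\<rangle>"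
  have f': "f' \<in> hom E ((J \<times>\<^sub>c ?S) \<times>\<^sub>c A) (TO T B)"
    using f by (simp add: f'_def hom_iff)
  have f'': "f'' \<in> hom E ((J \<times>\<^sub>c A) \<times>\<^sub>c A) (TO T B)"
    using f by (simp add: f''_def hom_iff)
  have p: "proj1 A \<cdot> pr2 E J ?S \<in> hom E (J \<times>\<^sub>c ?S) (TO T A)"
    "proj2 A \<cdot> pr2 E J ?S \<in> hom E (J \<times>\<^sub>c ?S) (TO T A)"
    by (simp_all add: hom_iff)
  have G: "G1 \<in> hom E (J \<times>\<^sub>c ?S) (TO T B)" "G2 \<in> hom E (J \<times>\<^sub>c ?S) (TO T B)"
    unfolding G1_def G2_def by (rule bind_hom; use p f' in simp)+
  have bP: "bind A B f P = bind ?S B G1 W" "bind A B f Q = bind ?S B G2 W"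
    unfolding P_eq Q_eq G1_def G2_def f'_def
    by (rule bind_mu_TA; use W f proj_props in simp)+
  \<comment> \<open>Restriction along an injection leaves the J-component untouched, and
    \<open>f'\<close> sees nothing else of its parameter.\<close>
  have stage: "bind A B f' k \<cdot> u = bind A B f'' (k \<cdot> u)"
    if "k \<in> hom E (J \<times>\<^sub>c ?S) (TO T A)" "u \<in> hom E (J \<times>\<^sub>c A) (J \<times>\<^sub>c ?S)" "pr1 E J ?S \<cdot> u = pr1 E J A" for k u
  proof -
    have "pr1 E J ?S \<cdot> u \<cdot> pr1 E (J \<times>\<^sub>c A) A = pr1 E J A \<cdot> pr1 E (J \<times>\<^sub>c A) A"
      using that by (subst Comp_reassoc[OF that(3)]) (simp_all add: hom_iff)
    then show ?thesis
      using that f bind_comp[OF that(1) f' that(2)] by (simp add: f'_def f''_def hom_iff)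
  qed
  have unit: "bind A B f'' (eta T A \<cdot> pr2 E J A) = f"
    using f f'' by (subst bind_eta[of _ "J \<times>\<^sub>c A"]) (simp_all add: f''_def hom_iff)
  have zero: "bind A B f'' (zero_arr A A \<cdot> pr2 E J A) = zero_pt B \<cdot> bang (J \<times>\<^sub>c A)"
    using bind_zero[OF f''] by (simp add: zero_arr_def)
  have u: "\<langle>pr1 E J A, in1 E A A \<cdot> pr2 E J A\<rangle> \<in> hom E (J \<times>\<^sub>c A) (J \<times>\<^sub>c ?S)"
    "\<langle>pr1 E J A, in2 E A A \<cdot> pr2 E J A\<rangle> \<in> hom E (J \<times>\<^sub>c A) (J \<times>\<^sub>c ?S)"
    by (simp_all add: hom_iff)
  have pin: "proj1 A \<cdot> in1 E A A \<cdot> pr2 E J A = eta T A \<cdot> pr2 E J A"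
    "proj1 A \<cdot> in2 E A A \<cdot> pr2 E J A = zero_arr A A \<cdot> pr2 E J A"
    "proj2 A \<cdot> in1 E A A \<cdot> pr2 E J A = zero_arr A A \<cdot> pr2 E J A"
    "proj2 A \<cdot> in2 E A A \<cdot> pr2 E J A = eta T A \<cdot> pr2 E J A"
    by (rule Comp_reassoc; use proj_props in simp)+
  have cin: "codiagonal A \<cdot> in1 E A A \<cdot> pr2 E J A = pr2 E J A"
    "codiagonal A \<cdot> in2 E A A \<cdot> pr2 E J A = pr2 E J A"
    using Comp_reassoc[OF codiagonal_props(2)[OF o(1)], of "pr2 E J A"]
      Comp_reassoc[OF codiagonal_props(3)[OF o(1)], of "pr2 E J A"] by simp_all
  \<comment> \<open>The codiagonal undoes either injection, so the left side restricts to
    \<open>f\<close> on both summands; \<open>G1\<close> and \<open>G2\<close> restrict to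
    \<open>f\<close> and zero on the first, to zero and \<open>f\<close> on the second.\<close>
  have GG: "f \<cdot> \<langle>pr1 E J ?S, codiagonal A \<cdot> pr2 E J ?S\<rangle> = add B \<cdot> \<langle>G1, G2\<rangle>"
  proof (rule Prod_Coprod_eqI)
    have "G1 \<cdot> \<langle>pr1 E J A, in1 E A A \<cdot> pr2 E J A\<rangle> = f"
      "G2 \<cdot> \<langle>pr1 E J A, in1 E A A \<cdot> pr2 E J A\<rangle> = zero_pt B \<cdot> bang (J \<times>\<^sub>c A)"
      unfolding G1_def G2_def stage[OF p(1) u(1), simplified] stage[OF p(2) u(1), simplified]
      using unit zero pin by simp_all
    then show "(f \<cdot> \<langle>pr1 E J ?S, codiagonal A \<cdot> pr2 E J ?S\<rangle>) \<cdot> \<langle>pr1 E J A, in1 E A A \<cdot> pr2 E J A\<rangle>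
        = (add B \<cdot> \<langle>G1, G2\<rangle>) \<cdot> \<langle>pr1 E J A, in1 E A A \<cdot> pr2 E J A\<rangle>"
      using f G u cin add_zero[OF f o(2)] by (simp add: hom_iff)
    have "G1 \<cdot> \<langle>pr1 E J A, in2 E A A \<cdot> pr2 E J A\<rangle> = zero_pt B \<cdot> bang (J \<times>\<^sub>c A)"
      "G2 \<cdot> \<langle>pr1 E J A, in2 E A A \<cdot> pr2 E J A\<rangle> = f"
      unfolding G1_def G2_def stage[OF p(1) u(2), simplified] stage[OF p(2) u(2), simplified]
      using unit zero pin by simp_all
    then show "(f \<cdot> \<langle>pr1 E J ?S, codiagonal A \<cdot> pr2 E J ?S\<rangle>) \<cdot> \<langle>pr1 E J A, in2 E A A \<cdot> pr2 E J A\<rangle>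
        = (add B \<cdot> \<langle>G1, G2\<rangle>) \<cdot> \<langle>pr1 E J A, in2 E A A \<cdot> pr2 E J A\<rangle>"
      using f G u cin zero_add[OF f o(2)] by (simp add: hom_iff)
  qed (use f G in \<open>simp_all add: hom_iff\<close>)
  have "bind A B f (add A \<cdot> \<langle>P, Q\<rangle>) = bind A B f (TA T (codiagonal A) \<cdot> W)"
    unfolding P_eq Q_eq using W by (simp add: add_proj)
  also have "\<dots> = bind ?S B (f \<cdot> \<langle>pr1 E J ?S, codiagonal A \<cdot> pr2 E J ?S\<rangle>) W"
    by (rule bind_TA_right) (use W f codiagonal_props in auto)
  also have "\<dots> = add B \<cdot> \<langle>bind A B f P, bind A B f Q\<rangle>"
    unfolding GG bP by (rule bind_add_left) (use W G in auto)
  finally show ?thesis .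
qed

lemma smult_hom:
  "\<lbrakk>r \<in> hom E J R; P \<in> hom E J (TO T X); X \<in> Obj E\<rbrakk> \<Longrightarrow> smult X \<cdot> \<langle>r, P\<rangle> \<in> hom E J (TO T X)"
  by (simp add: hom_iff)

text \<open>By \<open>smult_bind\<close> the scalar is the element being integrated, so this is the
  harder additivity \<open>bind_add_right\<close>; additivity in the module element is
  \<open>bind_add_left\<close>.\<close>

lemma smult_add_left:
  assumes "r \<in> hom E J R" "s \<in> hom E J R" "P \<in> hom E J (TO T X)" "X \<in> Obj E"
  shows "smult X \<cdot> \<langle>add \<one> \<cdot> \<langle>r, s\<rangle>, P\<rangle> = add X \<cdot> \<langle>smult X \<cdot> \<langle>r, P\<rangle>, smult X \<cdot> \<langle>s, P\<rangle>\<rangle>"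
proof -
  have [simp]: "J \<in> Obj E" using assms hom_Obj by blast
  have "P \<cdot> pr1 E J \<one> \<in> hom E (J \<times>\<^sub>c \<one>) (TO T X)"
    using assms by (simp add: hom_iff)
  then show ?thesis
    using assms add_pair_hom[OF assms(1,2)] by (simp add: smult_bind[where J = J] bind_add_right)
qed

lemma smult_add_right:
  assumes "r \<in> hom E J R" "P \<in> hom E J (TO T X)" "Q \<in> hom E J (TO T X)" "X \<in> Obj E"
  shows "smult X \<cdot> \<langle>r, add X \<cdot> \<langle>P, Q\<rangle>\<rangle> = add X \<cdot> \<langle>smult X \<cdot> \<langle>r, P\<rangle>, smult X \<cdot> \<langle>r, Q\<rangle>\<rangle>"
proof -
  have [simp]: "J \<in> Obj E" using assms hom_Obj by blast
  have 1: "P \<cdot> pr1 E J \<one> \<in> hom E (J \<times>\<^sub>c \<one>) (TO T X)" "Q \<cdot> pr1 E J \<one> \<in> hom E (J \<times>\<^sub>c \<one>) (TO T X)"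
    using assms by (simp_all add: hom_iff)
  have 2: "(add X \<cdot> \<langle>P, Q\<rangle>) \<cdot> pr1 E J \<one> = add X \<cdot> \<langle>P \<cdot> pr1 E J \<one>, Q \<cdot> pr1 E J \<one>\<rangle>"
    using assms by (simp add: hom_iff)
  show ?thesis
    unfolding smult_bind[OF assms(1,2,4)] smult_bind[OF assms(1,3,4)]
      smult_bind[OF assms(1) add_pair_hom[OF assms(2,3,4)] assms(4)] 2
    by (rule bind_add_left[OF assms(1) 1]) (use assms in auto)
qed

lemma smult_zero:
  assumes "r \<in> hom E J R" "X \<in> Obj E"
  shows "smult X \<cdot> \<langle>r, zero_pt X \<cdot> bang J\<rangle> = zero_pt X \<cdot> bang J"
proof -
  have z: "zero_pt X \<cdot> bang J \<in> hom E J (TO T X)"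
    using assms hom_Obj zero_hom by blast
  note s = smult_hom[OF assms(1) z assms(2)]
  show ?thesis
    by (rule add_left_cancel[OF _ s s z assms(2)])
      (use smult_add_right[OF assms(1) z z assms(2)] add_zero[OF z assms(2)] add_zero[OF s assms(2)] in simp)
qed

lemma smult_neg:
  assumes "r \<in> hom E J R" "P \<in> hom E J (TO T X)" "X \<in> Obj E"
  shows "smult X \<cdot> \<langle>r, neg X \<cdot> P\<rangle> = neg X \<cdot> smult X \<cdot> \<langle>r, P\<rangle>"
proof -
  note n = neg_comp_hom[OF assms(2,3)]
  have "add X \<cdot> \<langle>neg X \<cdot> P, P\<rangle> = zero_pt X \<cdot> bang J"
    using add_commute[OF n assms(2,3)] neg_props(2)[OF assms(3,2)] by simp
  then have "add X \<cdot> \<langle>smult X \<cdot> \<langle>r, neg X \<cdot> P\<rangle>, smult X \<cdot> \<langle>r, P\<rangle>\<rangle> = zero_pt X \<cdot> bang J"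
    using smult_add_right[OF assms(1) n assms(2,3)] smult_zero[OF assms(1,3)] by simp
  then show ?thesis
    using add_eq_zero_iff[OF smult_hom[OF assms(1) n assms(3)] smult_hom[OF assms]] assms(3) by simp
qed

end

section \<open>Cancellation of d, existence of derivatives, and the formula\<close>

context KL_monad
begin

lemma inclusion_comp_hom: "d \<in> hom E J D \<Longrightarrow> \<iota> \<cdot> d \<in> hom E J R"
  using Comp_hom subobject(1) by blast

lemma ex1_derivative:
  "\<lbrakk>f \<in> hom E (I \<times>\<^sub>c R) (TO T X); I \<in> Obj E; X \<in> Obj E\<rbrakk>
    \<Longrightarrow> \<exists>!f'. is_derivative D \<iota> (TO T X) (add X) (smult X) I f f'"
  using KL_module[of X] unfolding KL_def by blast

text \<open>If \<open>d \<cdot> a = d \<cdot> b\<close> for all \<open>d\<close>, then \<open>a\<close> and \<open>b\<close> are both derivatives of \<open>x \<mapsto> x \<cdot> a\<close>.\<close>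

lemma smult_D_cancel:
  assumes a: "a \<in> hom E I (TO T X)" and b: "b \<in> hom E I (TO T X)" and X: "X \<in> Obj E"
    and eq: "\<And>J i d. \<lbrakk>i \<in> hom E J I; d \<in> hom E J D\<rbrakk>
      \<Longrightarrow> smult X \<cdot> \<langle>\<iota> \<cdot> d, a \<cdot> i\<rangle> = smult X \<cdot> \<langle>\<iota> \<cdot> d, b \<cdot> i\<rangle>"
  shows "a = b"
proof -
  have I [simp]: "I \<in> Obj E" using a hom_Obj by blast
  note [simp] = X
  define f where "f = smult X \<cdot> \<langle>pr2 E I R, a \<cdot> pr1 E I R\<rangle>"
  have f: "f \<in> hom E (I \<times>\<^sub>c R) (TO T X)"
    using a by (simp add: f_def hom_iff)
  have deriv: "is_derivative D \<iota> (TO T X) (add X) (smult X) I f (c \<cdot> pr1 E I R)"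
    if c: "c \<in> hom E I (TO T X)"
      and eq': "\<And>J i d. \<lbrakk>i \<in> hom E J I; d \<in> hom E J D\<rbrakk>
        \<Longrightarrow> smult X \<cdot> \<langle>\<iota> \<cdot> d, a \<cdot> i\<rangle> = smult X \<cdot> \<langle>\<iota> \<cdot> d, c \<cdot> i\<rangle>" for c
    unfolding is_derivative_def
  proof (intro conjI ballI)
    show "c \<cdot> pr1 E I R \<in> hom E (I \<times>\<^sub>c R) (TO T X)"
      using c by (simp add: hom_iff)
    fix J i x d
    assume h: "J \<in> Obj E" "i \<in> hom E J I" "x \<in> hom E J R" "d \<in> hom E J D"
    note d = inclusion_comp_hom[OF h(4)]
    have fi: "f \<cdot> \<langle>i, y\<rangle> = smult X \<cdot> \<langle>y, a \<cdot> i\<rangle>" if "y \<in> hom E J R" for y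
      using that h a by (simp add: f_def hom_iff)
    have ci: "(c \<cdot> pr1 E I R) \<cdot> \<langle>i, x\<rangle> = c \<cdot> i"
      using h c by (simp add: hom_iff)
    \<comment> \<open>The derivative condition is distributivity, (x + d).a = x.a + d.a, with d.a
      rewritten as d.c.\<close>
    show "f \<cdot> \<langle>i, add \<one> \<cdot> \<langle>x, \<iota> \<cdot> d\<rangle>\<rangle>
        = add X \<cdot> \<langle>f \<cdot> \<langle>i, x\<rangle>, smult X \<cdot> \<langle>\<iota> \<cdot> d, (c \<cdot> pr1 E I R) \<cdot> \<langle>i, x\<rangle>\<rangle>\<rangle>"
      unfolding fi[OF h(3)] fi[OF add_pair_hom[OF h(3) d Terminal_Obj]] ci eq'[OF h(2,4), symmetric]
      by (rule smult_add_left[OF h(3) d Comp_hom[OF h(2) a] X])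
  qed
  have "is_derivative D \<iota> (TO T X) (add X) (smult X) I f (b \<cdot> pr1 E I R)"
    by (rule deriv[OF b]) (rule eq)
  then have "a \<cdot> pr1 E I R = b \<cdot> pr1 E I R"
    using ex1_derivative[OF f I X] deriv[OF a refl] by metis
  \<comment> \<open>KL uniqueness equates the two constant families; restriction to x = 0, a section
    of the projection, returns \<open>a\<close> and \<open>b\<close>.\<close>
  then have "(a \<cdot> pr1 E I R) \<cdot> \<langle>Id E I, zero_pt \<one> \<cdot> bang I\<rangle> = (b \<cdot> pr1 E I R) \<cdot> \<langle>Id E I, zero_pt \<one> \<cdot> bang I\<rangle>"
    by (rule arg_cong)
  then show ?thesis
    using a b by (simp add: hom_iff)
qed

lemma translate_bind:
  assumes "u \<in> hom E J R" "Q \<in> hom E J (TO T R)"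
  shows "translate u Q = bind R R (eta T R \<cdot> add \<one> \<cdot> \<langle>pr2 E J R, u \<cdot> pr1 E J R\<rangle>) Q"
proof -
  have [simp]: "J \<in> Obj E" using assms hom_Obj by blast
  let ?a = "add \<one> \<cdot> \<langle>pr2 E R R, pr1 E R R\<rangle>"
  have W: "str T R R \<cdot> \<langle>u, Q\<rangle> \<in> hom E J (TO T (R \<times>\<^sub>c R))"
    using assms by (simp add: hom_iff)
  have "translate u Q = TA T ?a \<cdot> str T R R \<cdot> \<langle>u, Q\<rangle>"
    using assms by (simp add: translate_def T_fam_def hom_iff)
  also have "\<dots> = mu T R \<cdot> TA T (eta T R) \<cdot> TA T ?a \<cdot> str T R R \<cdot> \<langle>u, Q\<rangle>"
    using W by (intro mu_T_eta_Comp[symmetric, where J = J]) (simp_all add: hom_iff)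
  also have "\<dots> = mu T R \<cdot> TA T (eta T R \<cdot> ?a) \<cdot> str T R R \<cdot> \<langle>u, Q\<rangle>"
    using W by (simp add: TA_Comp_Comp hom_iff)
  also have "\<dots> = bind R R ((eta T R \<cdot> ?a) \<cdot> \<langle>u \<cdot> pr1 E J R, pr2 E J R\<rangle>) Q"
    using assms by (intro bind_pair) (simp_all add: hom_iff)
  finally show ?thesis
    using assms by (simp add: hom_iff)
qed

lemma translate_hom:
  assumes "u \<in> hom E J R" "Q \<in> hom E J (TO T R)"
  shows "translate u Q \<in> hom E J (TO T R)"
proof -
  have [simp]: "J \<in> Obj E" using assms hom_Obj by blast
  show ?thesis
    unfolding translate_bind[OF assms] by (rule bind_hom) (use assms in \<open>simp_all add: hom_iff\<close>)
qed

lemma translate_comp: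
  assumes "u \<in> hom E J R" "Q \<in> hom E J (TO T R)" "i \<in> hom E K J"
  shows "translate u Q \<cdot> i = translate (u \<cdot> i) (Q \<cdot> i)"
proof -
  have [simp]: "J \<in> Obj E" using assms hom_Obj by blast
  show ?thesis
    using assms by (simp add: translate_def T_fam_def hom_iff)
qed

lemma translate_zero:
  assumes "Q \<in> hom E J (TO T R)"
  shows "translate (zero_pt \<one> \<cdot> bang J) Q = Q"
proof -
  have [simp]: "J \<in> Obj E" using assms hom_Obj by blast
  have "add \<one> \<cdot> \<langle>pr2 E J R, zero_pt \<one> \<cdot> bang (J \<times>\<^sub>c R)\<rangle> = pr2 E J R"
    by (rule add_zero) (simp_all add: hom_iff)
  then show ?thesis
    using assms translate_bind[OF zero_hom[of J \<one>] assms] bind_eta_right[of Q J R] by simp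
qed

text \<open>Translation is an extension along the unit, so associativity and the unit law turn it
  into a substitution in the integrand.\<close>

lemma bind_translate:
  assumes "u \<in> hom E J R" "Q \<in> hom E J (TO T R)" "f \<in> hom E (J \<times>\<^sub>c R) (TO T X)" "X \<in> Obj E"
  shows "bind R X f (translate u Q) = bind R X (f \<cdot> \<langle>pr1 E J R, add \<one> \<cdot> \<langle>pr2 E J R, u \<cdot> pr1 E J R\<rangle>\<rangle>) Q"
proof -
  have [simp]: "J \<in> Obj E" using assms hom_Obj by blast
  let ?t = "add \<one> \<cdot> \<langle>pr2 E J R, u \<cdot> pr1 E J R\<rangle>"
  have t: "?t \<in> hom E (J \<times>\<^sub>c R) R"
    using assms by (simp add: hom_iff)
  let ?f = "f \<cdot> \<langle>pr1 E J R \<cdot> pr1 E (J \<times>\<^sub>c R) R, pr2 E (J \<times>\<^sub>c R) R\<rangle>"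
  have "bind R X f (translate u Q) = bind R X (bind R X ?f (eta T R \<cdot> ?t)) Q"
    unfolding translate_bind[OF assms(1,2)]
    by (rule bind_bind) (use assms in \<open>simp_all add: hom_iff\<close>)
  also have "bind R X ?f (eta T R \<cdot> ?t) = ?f \<cdot> \<langle>Id E (J \<times>\<^sub>c R), ?t\<rangle>"
    by (rule bind_eta[OF t]) (use assms in \<open>simp_all add: hom_iff\<close>)
  finally show ?thesis
    using assms by (simp add: hom_iff)
qed

text \<open>The derivative of \<open>P\<close> is \<open>-f'(0)\<close> for \<open>f(x) = \<alpha>\<^sup>x\<^sub>* P\<close>.\<close>

lemma ex_dist_deriv:
  assumes P: "P \<in> hom E I (TO T R)"
  obtains P' where "P' \<in> hom E I (TO T R)"
    "\<forall>J\<in>Obj E. \<forall>i\<in>hom E J I. \<forall>d\<in>hom E J D.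
      smult R \<cdot> \<langle>\<iota> \<cdot> d, P' \<cdot> i\<rangle> = add R \<cdot> \<langle>P \<cdot> i, neg R \<cdot> translate (\<iota> \<cdot> d) (P \<cdot> i)\<rangle>"
proof -
  have I [simp]: "I \<in> Obj E" using P hom_Obj by blast
  have R: "R \<in> Obj E" by simp
  \<comment> \<open>The stage is enlarged by R so that the amount of translation is the generic
    element.\<close>
  define f where "f = translate (pr2 E I R) (P \<cdot> pr1 E I R)"
  have p: "pr2 E I R \<in> hom E (I \<times>\<^sub>c R) R" "P \<cdot> pr1 E I R \<in> hom E (I \<times>\<^sub>c R) (TO T R)"
    using P by (simp_all add: hom_iff)
  have f: "f \<in> hom E (I \<times>\<^sub>c R) (TO T R)"
    unfolding f_def by (rule translate_hom[OF p])
  obtain g where g: "is_derivative D \<iota> (TO T R) (add R) (smult R) I f g"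
    using ex1_derivative[OF f I R] by blast
  have gh: "g \<in> hom E (I \<times>\<^sub>c R) (TO T R)"
    by (rule is_derivative_hom[OF g])
  define z where "z = zero_pt \<one> \<cdot> bang I"
  have z: "z \<in> hom E I R"
    by (simp add: z_def hom_iff)
  define Q where "Q = g \<cdot> \<langle>Id E I, z\<rangle>"
  have Q: "Q \<in> hom E I (TO T R)"
    using gh z by (simp add: Q_def hom_iff)
  show thesis
  proof (rule that; (intro ballI)?)
    show "neg R \<cdot> Q \<in> hom E I (TO T R)"
      by (rule neg_comp_hom[OF Q R])
    fix J i d assume J: "J \<in> Obj E" and i: "i \<in> hom E J I" and d: "d \<in> hom E J D"
    note d' = inclusion_comp_hom[OF d]
    have Pi: "P \<cdot> i \<in> hom E J (TO T R)" and Qi: "Q \<cdot> i \<in> hom E J (TO T R)"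
      using Comp_hom[OF i] P Q by auto
    have zi: "z \<cdot> i = zero_pt \<one> \<cdot> bang J" and z0: "zero_pt \<one> \<cdot> bang J \<in> hom E J R"
      using i J by (simp_all add: z_def hom_iff)
    have fi: "f \<cdot> \<langle>i, y\<rangle> = translate y (P \<cdot> i)" if y: "y \<in> hom E J R" for y
      unfolding f_def using translate_comp[OF p, of "\<langle>i, y\<rangle>" J] P i y by (simp add: hom_iff)
    have gi: "g \<cdot> \<langle>i, zero_pt \<one> \<cdot> bang J\<rangle> = Q \<cdot> i"
      using zi gh z i by (simp add: Q_def hom_iff)
    have "f \<cdot> \<langle>i, add \<one> \<cdot> \<langle>zero_pt \<one> \<cdot> bang J, \<iota> \<cdot> d\<rangle>\<rangle>
        = add R \<cdot> \<langle>f \<cdot> \<langle>i, zero_pt \<one> \<cdot> bang J\<rangle>,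
            smult R \<cdot> \<langle>\<iota> \<cdot> d, g \<cdot> \<langle>i, zero_pt \<one> \<cdot> bang J\<rangle>\<rangle>\<rangle>"
      using g J i d z0 unfolding is_derivative_def by blast
    \<comment> \<open>At x = 0 the KL condition expresses the translate as P + d.Q, while the
      derivative of P is the coefficient in the opposite difference; hence the witness
      \<open>neg R \<cdot> Q\<close>.\<close>
    then have t: "translate (\<iota> \<cdot> d) (P \<cdot> i) = add R \<cdot> \<langle>P \<cdot> i, smult R \<cdot> \<langle>\<iota> \<cdot> d, Q \<cdot> i\<rangle>\<rangle>"
      unfolding gi fi[OF z0] translate_zero[OF Pi] zero_add[OF d' Terminal_Obj] fi[OF d'] .
    note s = smult_hom[OF d' Qi R]
    note ns = neg_comp_hom[OF s R]
    have n: "smult R \<cdot> \<langle>\<iota> \<cdot> d, (neg R \<cdot> Q) \<cdot> i\<rangle> = neg R \<cdot> smult R \<cdot> \<langle>\<iota> \<cdot> d, Q \<cdot> i\<rangle>"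
      using smult_neg[OF d' Qi R] Comp_assoc[OF i Q neg_props(1)[OF R]] by simp
    have "add R \<cdot> \<langle>neg R \<cdot> smult R \<cdot> \<langle>\<iota> \<cdot> d, Q \<cdot> i\<rangle>, translate (\<iota> \<cdot> d) (P \<cdot> i)\<rangle> = P \<cdot> i"
      unfolding t add_commute[OF ns add_pair_hom[OF Pi s R] R] add_assoc[OF Pi s ns R]
        neg_props(2)[OF R s] by (rule add_zero[OF Pi R])
    then show "smult R \<cdot> \<langle>\<iota> \<cdot> d, (neg R \<cdot> Q) \<cdot> i\<rangle>
        = add R \<cdot> \<langle>P \<cdot> i, neg R \<cdot> translate (\<iota> \<cdot> d) (P \<cdot> i)\<rangle>"
      unfolding n using add_eq_iff[OF ns translate_hom[OF d' Pi] Pi R] by blast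
  qed
qed

text \<open>The description is justified by \<open>ex_dist_deriv\<close> and
  \<open>smult_D_cancel\<close>. The defining equation is rearranged to avoid negation, so that
  additivity of the pairing applies directly.\<close>

lemma dist_deriv_props:
  assumes P: "P \<in> hom E I (TO T R)"
  shows "dist_deriv D \<iota> I P \<in> hom E I (TO T R)"
    "\<And>J i d. \<lbrakk>i \<in> hom E J I; d \<in> hom E J D\<rbrakk> \<Longrightarrow>
      add R \<cdot> \<langle>smult R \<cdot> \<langle>\<iota> \<cdot> d, dist_deriv D \<iota> I P \<cdot> i\<rangle>, translate (\<iota> \<cdot> d) (P \<cdot> i)\<rangle> = P \<cdot> i"
proof -
  have R: "R \<in> Obj E" by simp
  let ?Q = "\<lambda>P'. P' \<in> hom E I (TO T R) \<and>
     (\<forall>J\<in>Obj E. \<forall>i\<in>hom E J I. \<forall>d\<in>hom E J D.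
        smult R \<cdot> \<langle>\<iota> \<cdot> d, P' \<cdot> i\<rangle>
          = add R \<cdot> \<langle>P \<cdot> i, neg R \<cdot> translate (\<iota> \<cdot> d) (P \<cdot> i)\<rangle>)"
  obtain P' where P': "?Q P'"
    by (rule ex_dist_deriv[OF P]) (intro conjI that)
  have uniq: "Q = P'" if Q: "?Q Q" for Q
  proof (rule smult_D_cancel[OF _ _ R])
    show "smult R \<cdot> \<langle>\<iota> \<cdot> d, Q \<cdot> i\<rangle> = smult R \<cdot> \<langle>\<iota> \<cdot> d, P' \<cdot> i\<rangle>"
      if id: "i \<in> hom E J I" "d \<in> hom E J D" for J i d
    proof -
      have "smult R \<cdot> \<langle>\<iota> \<cdot> d, S \<cdot> i\<rangle> = add R \<cdot> \<langle>P \<cdot> i, neg R \<cdot> translate (\<iota> \<cdot> d) (P \<cdot> i)\<rangle>"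
        if "?Q S" for S
        using that id hom_Obj(1)[OF id(1)] by blast
      from this[OF Q] this[OF P'] show ?thesis
        by (rule trans[OF _ sym])
    qed
  qed (use Q P' in blast)+
  have *: "?Q (dist_deriv D \<iota> I P)"
    unfolding dist_deriv_def by (rule theI[of ?Q P', OF P' uniq])
  then show 1: "dist_deriv D \<iota> I P \<in> hom E I (TO T R)"
    by (rule conjunct1)
  fix J i d assume i: "i \<in> hom E J I" and d: "d \<in> hom E J D"
  have J: "J \<in> Obj E" using i hom_Obj by blast
  note d' = inclusion_comp_hom[OF d] and Pi = Comp_hom[OF i P] and Di = Comp_hom[OF i 1]
  show "add R \<cdot> \<langle>smult R \<cdot> \<langle>\<iota> \<cdot> d, dist_deriv D \<iota> I P \<cdot> i\<rangle>, translate (\<iota> \<cdot> d) (P \<cdot> i)\<rangle> = P \<cdot> i"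
    by (rule iffD2[OF add_eq_iff[OF smult_hom[OF d' Di R] translate_hom[OF d' Pi] Pi R]])
      (use * J i d in blast)
qed

lemma fun_deriv_props:
  assumes "\<phi> \<in> hom E I (Exp E R (TO T X))" "I \<in> Obj E" "X \<in> Obj E"
  shows "fun_deriv D \<iota> X I \<phi> \<in> hom E I (Exp E R (TO T X))"
    "is_derivative D \<iota> (TO T X) (add X) (smult X) I
      (uncurry R (TO T X) \<phi>) (uncurry R (TO T X) (fun_deriv D \<iota> X I \<phi>))"
proof -
  have u: "uncurry R (TO T X) \<phi> \<in> hom E (I \<times>\<^sub>c R) (TO T X)"
    using assms by (intro uncurry_hom) auto
  let ?g = "THE f'. is_derivative D \<iota> (TO T X) (add X) (smult X) I (uncurry R (TO T X) \<phi>) f'"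
  have g: "is_derivative D \<iota> (TO T X) (add X) (smult X) I (uncurry R (TO T X) \<phi>) ?g"
    by (rule theI'[OF ex1_derivative[OF u assms(2,3)]])
  have gh: "?g \<in> hom E (I \<times>\<^sub>c R) (TO T X)"
    by (rule is_derivative_hom[OF g])
  note c = curry_props[OF assms(2) TO_Obj[OF Terminal_Obj] gh]
  show "fun_deriv D \<iota> X I \<phi> \<in> hom E I (Exp E R (TO T X))"
    unfolding fun_deriv_def by (rule c(1))
  show "is_derivative D \<iota> (TO T X) (add X) (smult X) I
      (uncurry R (TO T X) \<phi>) (uncurry R (TO T X) (fun_deriv D \<iota> X I \<phi>))"
    unfolding fun_deriv_def c(2) by (rule g)
qed

theorem pairing_dist_deriv:
  assumes X: "X \<in> Obj E" and I: "I \<in> Obj E" and P: "P \<in> hom E I (TO T R)"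
    and \<phi>: "\<phi> \<in> hom E I (Exp E R (TO T X))"
  shows "pairing R (TO T X) (mu T X) (dist_deriv D \<iota> I P) \<phi>
    = neg X \<cdot> pairing R (TO T X) (mu T X) P (fun_deriv D \<iota> X I \<phi>)"
proof -
  note [simp] = X I
  have R: "R \<in> Obj E" by simp
  define f where "f = uncurry R (TO T X) \<phi>"
  define g where "g = uncurry R (TO T X) (fun_deriv D \<iota> X I \<phi>)"
  define P' where "P' = dist_deriv D \<iota> I P"
  have f: "f \<in> hom E (I \<times>\<^sub>c R) (TO T X)" and g: "g \<in> hom E (I \<times>\<^sub>c R) (TO T X)"
    unfolding f_def g_def using \<phi> fun_deriv_props(1)[OF \<phi> I X] by (auto intro!: uncurry_hom)
  have deriv: "f \<cdot> \<langle>i, add \<one> \<cdot> \<langle>x, \<iota> \<cdot> d\<rangle>\<rangle> = add X \<cdot> \<langle>f \<cdot> \<langle>i, x\<rangle>, smult X \<cdot> \<langle>\<iota> \<cdot> d, g \<cdot> \<langle>i, x\<rangle>\<rangle>\<rangle>"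
    if "i \<in> hom E J I" "x \<in> hom E J R" "d \<in> hom E J D" for J i x d
    using that hom_Obj(1)[OF that(1)] fun_deriv_props(2)[OF \<phi> I X]
    unfolding is_derivative_def f_def g_def by blast
  have P': "P' \<in> hom E I (TO T R)"
    unfolding P'_def by (rule dist_deriv_props(1)[OF P])
  define a where "a = bind R X f P'"
  define b where "b = bind R X g P"
  have a: "a \<in> hom E I (TO T X)" and b: "b \<in> hom E I (TO T X)"
    unfolding a_def b_def using P P' f g by (auto intro!: bind_hom)
  have "a = neg X \<cdot> b"
  proof (rule smult_D_cancel[OF a neg_comp_hom[OF b X] X])
    fix J i d assume i: "i \<in> hom E J I" and d: "d \<in> hom E J D"
    have J [simp]: "J \<in> Obj E" using i hom_Obj by blast
    note d' = inclusion_comp_hom[OF d]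
    note Pi = Comp_hom[OF i P] and P'i = Comp_hom[OF i P'] and ai = Comp_hom[OF i a] and bi = Comp_hom[OF i b]
    \<comment> \<open>Reindexing from I to J: \<open>f \<cdot> u\<close> and
      \<open>g \<cdot> u\<close> are the integrands at the stage where \<open>d\<close>
      lives.\<close>
    define u where "u = \<langle>i \<cdot> pr1 E J R, pr2 E J R\<rangle>"
    have u: "u \<in> hom E (J \<times>\<^sub>c R) (I \<times>\<^sub>c R)"
      using i by (simp add: u_def hom_iff)
    note fu = Comp_hom[OF u f] and gu = Comp_hom[OF u g]
    define p where "p = bind R X (f \<cdot> u) (P \<cdot> i)"
    have p: "p \<in> hom E J (TO T X)"
      unfolding p_def by (rule bind_hom[OF Pi fu R X])
    have a_i: "a \<cdot> i = bind R X (f \<cdot> u) (P' \<cdot> i)" and b_i: "b \<cdot> i = bind R X (g \<cdot> u) (P \<cdot> i)"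
      unfolding a_def b_def u_def by (rule bind_comp[OF P' f i R X], rule bind_comp[OF P g i R X])
    have d1: "(\<iota> \<cdot> d) \<cdot> pr1 E J R \<in> hom E (J \<times>\<^sub>c R) R"
      using Comp_hom[OF pr1_hom[OF J R] d'] .
    \<comment> \<open>The KL condition is used at the generic point \<open>pr2 E J R\<close> of R,
      which forces \<open>i\<close> and \<open>d\<close> to be pulled back along
      \<open>pr1 E J R\<close>.\<close>
    have shift: "(f \<cdot> u) \<cdot> \<langle>pr1 E J R, add \<one> \<cdot> \<langle>pr2 E J R, (\<iota> \<cdot> d) \<cdot> pr1 E J R\<rangle>\<rangle>
        = add X \<cdot> \<langle>f \<cdot> u, smult X \<cdot> \<langle>(\<iota> \<cdot> d) \<cdot> pr1 E J R, g \<cdot> u\<rangle>\<rangle>"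
    proof -
      have 1: "i \<cdot> pr1 E J R \<in> hom E (J \<times>\<^sub>c R) I" "pr2 E J R \<in> hom E (J \<times>\<^sub>c R) R"
        "d \<cdot> pr1 E J R \<in> hom E (J \<times>\<^sub>c R) D"
        using i d by (simp_all add: hom_iff)
      have 2: "(\<iota> \<cdot> d) \<cdot> pr1 E J R = \<iota> \<cdot> d \<cdot> pr1 E J R"
        using Comp_assoc[OF pr1_hom[OF J R] d subobject(1)] .
      have "(f \<cdot> u) \<cdot> \<langle>pr1 E J R, add \<one> \<cdot> \<langle>pr2 E J R, (\<iota> \<cdot> d) \<cdot> pr1 E J R\<rangle>\<rangle>
          = f \<cdot> \<langle>i \<cdot> pr1 E J R, add \<one> \<cdot> \<langle>pr2 E J R, \<iota> \<cdot> d \<cdot> pr1 E J R\<rangle>\<rangle>"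
        using f i d1 d subobject(1) by (simp add: u_def hom_iff)
      then show ?thesis
        using deriv[OF 1] unfolding 2 u_def by simp
    qed
    have "p = bind R X (f \<cdot> u) (add R \<cdot> \<langle>smult R \<cdot> \<langle>\<iota> \<cdot> d, P' \<cdot> i\<rangle>, translate (\<iota> \<cdot> d) (P \<cdot> i)\<rangle>)"
      unfolding p_def P'_def dist_deriv_props(2)[OF P i d] ..
    also have "\<dots> = add X \<cdot> \<langle>smult X \<cdot> \<langle>\<iota> \<cdot> d, a \<cdot> i\<rangle>, bind R X (f \<cdot> u) (translate (\<iota> \<cdot> d) (P \<cdot> i))\<rangle>"
      unfolding bind_add_right[OF smult_hom[OF d' P'i R] translate_hom[OF d' Pi] fu R X]
        bind_smult[OF d' P'i fu R X] a_i ..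
    also have "bind R X (f \<cdot> u) (translate (\<iota> \<cdot> d) (P \<cdot> i)) = add X \<cdot> \<langle>p, smult X \<cdot> \<langle>\<iota> \<cdot> d, b \<cdot> i\<rangle>\<rangle>"
      unfolding bind_translate[OF d' Pi fu X] shift
        bind_add_left[OF Pi fu smult_hom[OF d1 gu X] R X] smult_bind_commute[OF d' Pi gu R X] p_def b_i ..
    finally have main: "p = add X \<cdot> \<langle>smult X \<cdot> \<langle>\<iota> \<cdot> d, a \<cdot> i\<rangle>, add X \<cdot> \<langle>p, smult X \<cdot> \<langle>\<iota> \<cdot> d, b \<cdot> i\<rangle>\<rangle>\<rangle>" .
    note sa = smult_hom[OF d' ai X] and sb = smult_hom[OF d' bi X]
    \<comment> \<open>\<open>p\<close> stands on both sides of \<open>main\<close>; cancelling it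
      leaves d.a + d.b = 0.\<close>
    have "add X \<cdot> \<langle>p, add X \<cdot> \<langle>smult X \<cdot> \<langle>\<iota> \<cdot> d, a \<cdot> i\<rangle>, smult X \<cdot> \<langle>\<iota> \<cdot> d, b \<cdot> i\<rangle>\<rangle>\<rangle>
        = add X \<cdot> \<langle>p, zero_pt X \<cdot> bang J\<rangle>"
      using main add_assoc[OF sa p sb X] add_assoc[OF p sa sb X] add_commute[OF sa p X] add_zero[OF p X]
      by metis
    then have "add X \<cdot> \<langle>smult X \<cdot> \<langle>\<iota> \<cdot> d, a \<cdot> i\<rangle>, smult X \<cdot> \<langle>\<iota> \<cdot> d, b \<cdot> i\<rangle>\<rangle> = zero_pt X \<cdot> bang J"
      by (rule add_left_cancel[OF _ p add_pair_hom[OF sa sb X] zero_hom[OF J X] X])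
    then show "smult X \<cdot> \<langle>\<iota> \<cdot> d, a \<cdot> i\<rangle> = smult X \<cdot> \<langle>\<iota> \<cdot> d, (neg X \<cdot> b) \<cdot> i\<rangle>"
      using add_eq_zero_iff[OF sa sb X] smult_neg[OF d' bi X] Comp_assoc[OF i b neg_props(1)[OF X]]
      by simp
  qed
  then show ?thesis
    using pairing_bind[OF P' \<phi> X R] pairing_bind[OF P fun_deriv_props(1)[OF \<phi> I X] X R]
    by (simp add: a_def b_def f_def g_def P'_def)
qed

end

text \<open>\<open>P\<close> and \<open>\<phi>\<close> are generalized elements at an arbitrary
  common stage \<open>I\<close>, which is the internal reading of the formula; taking
  \<open>I\<close> terminal gives global elements.\<close>

theorem proposition13:
  fixes E :: "('o, 'm) bccc" and T :: "('o, 'm) str_monad"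
    and D X I :: 'o and \<iota> P \<phi> :: 'm
  assumes "KL_monad E T D \<iota>"
    and "X \<in> Obj E" and "I \<in> Obj E"
    and "P \<in> hom E I (TO T (TO T (Terminal E)))"
    and "\<phi> \<in> hom E I (Exp E (TO T (Terminal E)) (TO T X))"
  shows "strong_monad.pairing E T (TO T (Terminal E)) (TO T X) (mu T X)
           (strong_monad.dist_deriv E T D \<iota> I P) \<phi>
       = Comp E (strong_monad.neg E T X)
           (strong_monad.pairing E T (TO T (Terminal E)) (TO T X) (mu T X)
             P (strong_monad.fun_deriv E T D \<iota> X I \<phi>))"
  by (rule KL_monad.pairing_dist_deriv) (use assms in auto)

end
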